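(* Let $m\in\mathbb N$ and let $H^m=\bigoplus_{p+q=m}H^{p,q}$ be the Hodge decomposition of $H^m(X_v(\mathbb C),\mathbb C)$ for a smooth projective variety $X$ over a number field at a real archimedean place $v$ ($\mathbb K_v=\mathbb R$). Let $\pi(H^m,u)$ be the representation of the Weil group $W$ on $H^m$ described in the context. Then, for $z=\frac{1+m}{2}+is$ with $s\in\mathbb R$, $$\int'_{W}\frac{\mathrm{Trace}(\pi(H^m,u))\,|u|_{\mathbb H}^{z}}{|1-u|_{\mathbb H}}\,d^*u=-2\,\frac{d}{ds}\,\Im\log L_{\mathbb R}(H^m,z).$$
   Context: $\mathbb H=\mathbb C+\mathbb Cj$ is the division algebra of quaternions, $j^2=-1$, $jwj^{-1}=\bar w$ for $w\in\mathbb C$, and $|\cdot|_{\mathbb H}$ is the reduced norm. The Weil group $W=\mathbb C^*\cup\mathbb C^*j$ is the normalizer of $\mathbb C^*$ in $\mathbb H^*$; for $u=w$ or $u=wj$ in $W$ one has $|u|_{\mathbb H}=|u|_W=w\bar w$, and $|1-wj|_{\mathbb H}=1+w\bar w$, $|1-w|_{\mathbb H}=|1-w|^2$. Representation: for $\xi\in H^{p,q}$, $\pi(H^m,w)\xi=w^{-p}\bar w^{-q}\xi$ for $w\in\mathbb C^*$, and $\pi(H^m,j)\xi=i^{p+q}F_\infty(\xi)$, $\pi(H^m,wj)=\pi(H^m,w)\pi(H^m,j)$, where $F_\infty$ is the linear involution on $H^m$ induced by the geometric action of complex conjugation (it maps $H^{p,q}$ to $H^{q,p}$). Local factor (Serre):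 with $h^{p,q}=\dim H^{p,q}$, and, when $m=2p$, $h^{p,\pm}$ the dimension of the $\pm(-1)^p$-eigenspace of $F_\infty$ on $H^{p,p}$, and $\Gamma_{\mathbb C}(z)=(2\pi)^{-z}\Gamma(z)$, $\Gamma_{\mathbb R}(z)=2^{-1/2}\pi^{-z/2}\Gamma(z/2)$, $$L_{\mathbb R}(H^m,z)=\prod_{p<q,\;p+q=m}\Gamma_{\mathbb C}(z-p)^{h^{p,q}}\ \prod_{2p=m}\Gamma_{\mathbb R}(z-p)^{h^{p,+}}\,\Gamma_{\mathbb R}(z-p+1)^{h^{p,-}}.$$ Principal value $\int'$ (Weil's conventions): let $f_0(\nu)=\inf(\nu^{1/2},\nu^{-1/2})$, $f_1=f_0^{-1}-f_0$, $d^*\nu=d\nu/\nu$ on $\mathbb R_+^*$. For a function $\varphi$ on $W$ let $\psi(\nu)$ be the integral of $\varphi$ over the fiber $\{u\in W:|u|_W=\nu\}$ of the module map $W\to\mathbb R_+^*$, for the fiber measure normalized as a probability measure (invariant under the maximal compact subgroup, so that $\{w\}$ and $\{wj\}$ each have total mass $1/2$). If $\psi-c\,f_1^{-1}$ is integrable on $\mathbb R_+^*$, then $$\int'_W\varphi(u)\,d^*u=2\log(2\pi)\,c+\lim_{t\to\infty}\Big(\int_{\mathbb R_+^*}(1-f_0^{2t})\,\psi(\nu)\,d^*\nu-2c\log t\Big).$$ *)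

theory Defs
  imports "HOL-Analysis.Analysis"
begin

section \<open>Quaternions and the Weil group\<close>

text \<open>\<^term>\<open>Quat a b\<close> is the quaternion $a + bj$ with complex $a$, $b$; the product below encodes
  $j^2 = -1$ and $jw = \bar w j$.\<close>

datatype quaternion = Quat (cpart: complex) (jpart: complex)

instantiation quaternion :: division_ring
begin

definition "0 = Quat 0 0"
definition "1 = Quat 1 0"
definition "u + v = Quat (cpart u + cpart v) (jpart u + jpart v)"
definition "- u = Quat (- cpart u) (- jpart u)"
definition "u - v = Quat (cpart u - cpart v) (jpart u - jpart v)"
definition "u * v = Quat (cpart u * cpart v - jpart u * cnj (jpart v))
                         (cpart u * jpart v + jpart u * cnj (cpart v))"
definition "inverse u = (let n = complex_of_real ((cmod (cpart u))\<^sup>2 + (cmod (jpart u))\<^sup>2)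
                         in Quat (cnj (cpart u) / n) (- jpart u / n))"
definition "u div (v :: quaternion) = u * inverse v"

lemmas quaternion_defs = zero_quaternion_def one_quaternion_def plus_quaternion_def
  uminus_quaternion_def minus_quaternion_def times_quaternion_def

lemma quat_norm_nonzero:
  assumes "Quat a b \<noteq> 0"
  shows "a * cnj a + b * cnj b \<noteq> 0"
proof -
  have "a * cnj a + b * cnj b = complex_of_real ((cmod a)\<^sup>2 + (cmod b)\<^sup>2)"
    by (simp only: complex_norm_square of_real_add)
  moreover have "(cmod a)\<^sup>2 + (cmod b)\<^sup>2 \<noteq> 0"
    using assms by (simp add: quaternion_defs sum_power2_eq_zero_iff)
  ultimately show ?thesis by (simp only: of_real_eq_0_iff not_False_eq_True)
qed

instance
proof
  fix u :: quaternion
  assume nz: "u \<noteq> 0"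
  obtain a b where u: "u = Quat a b" by (cases u)
  have n: "a * cnj a + b * cnj b \<noteq> 0" using nz u quat_norm_nonzero by blast
  have c: "cnj (a * cnj a + b * cnj b) = a * cnj a + b * cnj b" by (simp add: mult.commute)
  have i: "inverse u = Quat (cnj a / (a * cnj a + b * cnj b)) (- b / (a * cnj a + b * cnj b))"
    by (simp only: u inverse_quaternion_def Let_def quaternion.sel of_real_add complex_norm_square)
  define N where "N = a * cnj a + b * cnj b"
  have i': "inverse u = Quat (cnj a / N) (- b / N)" and n': "N \<noteq> 0" and c': "cnj N = N"
    using i n c by (fold N_def)
  show "inverse u * u = 1" "u * inverse u = 1"
    unfolding i' times_quaternion_def one_quaternion_def
    using n' c' by (simp_all add: u add_divide_distrib[symmetric] mult.commute N_def[symmetric])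
qed (auto simp: quaternion_defs inverse_quaternion_def divide_quaternion_def algebra_simps
       intro: quaternion.expand)

end

definition quat_j :: quaternion where
  "quat_j = Quat 0 1"

text \<open>The reduced norm $u\bar u$ of $\mathbb{H}$ over the reals.\<close>

definition nrd :: "quaternion \<Rightarrow> real" where
  "nrd u = (cmod (cpart u))\<^sup>2 + (cmod (jpart u))\<^sup>2"

definition weil_group :: "quaternion set" where
  "weil_group = {Quat w 0 | w. w \<noteq> 0} \<union> {Quat w 0 * quat_j | w. w \<noteq> 0}"

lemma Quat_times_j: "Quat w 0 * quat_j = Quat 0 w"
  by (simp add: quat_j_def times_quaternion_def)

lemma quat_j_square: "quat_j * quat_j = -1"
  by (simp add: quat_j_def quaternion_defs)

lemma quat_j_conj: "quat_j * Quat w 0 * inverse quat_j = Quat (cnj w) 0"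
  by (simp add: quat_j_def times_quaternion_def inverse_quaternion_def)

lemma nrd_simps:
  "nrd (Quat w 0) = (cmod w)\<^sup>2" "nrd (Quat w 0 * quat_j) = (cmod w)\<^sup>2"
  "nrd (1 - Quat w 0) = (cmod (1 - w))\<^sup>2" "nrd (1 - Quat w 0 * quat_j) = 1 + (cmod w)\<^sup>2"
  unfolding Quat_times_j by (simp_all add: nrd_def quaternion_defs)

lemma weil_group_eq_normalizer:
  "weil_group = {u. u \<noteq> 0 \<and> (\<lambda>x. u * x * inverse u) ` {Quat w 0 | w. w \<noteq> 0} = {Quat w 0 | w. w \<noteq> 0}}"
  (is "_ = {u. u \<noteq> 0 \<and> ?c u ` ?C = ?C}")
proof (intro set_eqI iffI)
  fix u assume "u \<in> weil_group"
  then consider (c) w where "w \<noteq> 0" "u = Quat w 0" | (j) w where "w \<noteq> 0" "u = Quat 0 w"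
    by (auto simp: weil_group_def Quat_times_j)
  then show "u \<in> {u. u \<noteq> 0 \<and> ?c u ` ?C = ?C}"
  proof cases
    case c
    have "?c u (Quat x 0) = Quat x 0" for x
    proof -
      have "Quat w 0 * Quat x 0 = Quat x 0 * Quat w 0" by (simp add: times_quaternion_def)
      then show ?thesis using c by (simp add: mult.assoc zero_quaternion_def)
    qed
    then have "?c u ` ?C = (\<lambda>x. x) ` ?C" by (intro image_cong) auto
    then have "?c u ` ?C = ?C" by simp
    with c show ?thesis by (simp add: zero_quaternion_def)
  next
    case j
    have e: "?c u (Quat x 0) = Quat (cnj x) 0" for x
    proof -
      have "Quat 0 w * Quat x 0 = Quat (cnj x) 0 * Quat 0 w" by (simp add: times_quaternion_def)
      then show ?thesis using j by (simp add: mult.assoc zero_quaternion_def)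
    qed
    have "?c u ` ?C = ?C"
    proof (intro equalityI subsetI)
      fix y assume "y \<in> ?c u ` ?C"
      then obtain x where "x \<noteq> 0" "y = ?c u (Quat x 0)" by blast
      then show "y \<in> ?C" using e by auto
    next
      fix y assume "y \<in> ?C"
      then obtain x where x: "x \<noteq> 0" "y = Quat x 0" by blast
      then have "y = ?c u (Quat (cnj x) 0)" using e by simp
      moreover have "Quat (cnj x) 0 \<in> ?C" using x by simp
      ultimately show "y \<in> ?c u ` ?C" by blast
    qed
    with j show ?thesis by (simp add: zero_quaternion_def)
  qed
next
  fix u assume "u \<in> {u. u \<noteq> 0 \<and> ?c u ` ?C = ?C}"
  then have nz: "u \<noteq> 0" and im: "?c u ` ?C = ?C" by auto
  obtain a b where u: "u = Quat a b" by (cases u)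
  have "Quat \<i> 0 \<in> ?C" by simp
  then have "u * Quat \<i> 0 * inverse u \<in> ?C" using im by blast
  then obtain w where "u * Quat \<i> 0 * inverse u = Quat w 0" by blast
  then have "u * Quat \<i> 0 = Quat w 0 * u"
    using nz by (metis mult.assoc left_inverse mult.right_neutral)
  then have "a * \<i> = w * a" "- (b * \<i>) = w * b"
    by (simp_all add: u times_quaternion_def)
  then have "a = 0 \<or> w = \<i>" "b = 0 \<or> w = - \<i>"
    by (auto simp: mult.commute[of w]) (metis minus_mult_right mult_cancel_left)
  then have "a = 0 \<or> b = 0" by auto
  with nz show "u \<in> weil_group"
    by (auto simp: u weil_group_def Quat_times_j zero_quaternion_def)
qed

section \<open>Hodge decompositions and the representation of the Weil group\<close>

text \<open>The data carried by $H^m(X_v(\mathbb{C}),\mathbb{C})$ at a real place: a finite-dimensional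
  complex vector space (the type \<open>'v\<close>, with some basis \<open>Basis\<close>), the summands $H^{p,q}$ for
  $p + q = m$, and the linear involution \<open>F\<close> induced by complex conjugation.\<close>

locale real_hodge = finite_dimensional_vector_space scale Basis
  for scale :: "complex \<Rightarrow> 'v::ab_group_add \<Rightarrow> 'v" (infixr \<open>*s\<close> 75) and Basis :: "'v set" +
  fixes m :: nat and H :: "nat \<Rightarrow> nat \<Rightarrow> 'v set" and F :: "'v \<Rightarrow> 'v"
  assumes subspace_H: "p + q = m \<Longrightarrow> subspace (H p q)"
    and H_decompose: "\<exists>x. (\<forall>p q. p + q = m \<longrightarrow> x (p, q) \<in> H p q) \<and>
                          \<xi> = (\<Sum>i\<in>{(p, q). p + q = m}. x i)"
    and H_independent: "(\<And>p q. p + q = m \<Longrightarrow> x (p, q) \<in> H p q) \<Longrightarrow>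
                        (\<Sum>i\<in>{(p, q). p + q = m}. x i) = 0 \<Longrightarrow> p + q = m \<Longrightarrow> x (p, q) = 0"
    and linear_F: "Vector_Spaces.linear scale scale F"
    and F_involution: "F (F \<xi>) = \<xi>"
    and F_H: "p + q = m \<Longrightarrow> F ` H p q \<subseteq> H q p"
begin

definition component :: "'v \<Rightarrow> nat \<times> nat \<Rightarrow> 'v" where
  "component \<xi> = (SOME x. (\<forall>p q. p + q = m \<longrightarrow> x (p, q) \<in> H p q) \<and>
                          \<xi> = (\<Sum>i\<in>{(p, q). p + q = m}. x i))"

definition weil_rep_C :: "complex \<Rightarrow> 'v \<Rightarrow> 'v" where
  "weil_rep_C w \<xi> = (\<Sum>(p, q)\<in>{(p, q). p + q = m}.
     (w powi (- int p) * cnj w powi (- int q)) *s component \<xi> (p, q))"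

definition weil_rep_j :: "'v \<Rightarrow> 'v" where
  "weil_rep_j \<xi> = (\<Sum>(p, q)\<in>{(p, q). p + q = m}. (\<i> ^ (p + q)) *s F (component \<xi> (p, q)))"

text \<open>Only meaningful on the Weil group, that is, for $u = w$ or $u = wj$ with $w \neq 0$.\<close>

definition weil_rep :: "quaternion \<Rightarrow> 'v \<Rightarrow> 'v" where
  "weil_rep u \<xi> = (if jpart u = 0 then weil_rep_C (cpart u) \<xi>
                   else weil_rep_C (jpart u) (weil_rep_j \<xi>))"

text \<open>The trace of an endomorphism, as the sum of the diagonal entries of its matrix in
  \<open>Basis\<close>; it does not depend on the basis.\<close>

definition endo_trace :: "('v \<Rightarrow> 'v) \<Rightarrow> complex" where
  "endo_trace f = (\<Sum>b\<in>Basis. representation Basis (f b) b)"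

definition hodge_number :: "nat \<Rightarrow> nat \<Rightarrow> nat" where
  "hodge_number p q = dim (H p q)"

definition hodge_plus :: "nat \<Rightarrow> nat" where
  "hodge_plus p = dim {\<xi> \<in> H p p. F \<xi> = ((-1) ^ p) *s \<xi>}"

definition hodge_minus :: "nat \<Rightarrow> nat" where
  "hodge_minus p = dim {\<xi> \<in> H p p. F \<xi> = (- ((-1) ^ p)) *s \<xi>}"

lemma finite_bidegrees: "finite {(p, q). p + q = (m :: nat)}"
  by (rule finite_subset[of _ "{..m} \<times> {..m}"]) auto

lemma component_in: "p + q = m \<Longrightarrow> component \<xi> (p, q) \<in> H p q"
  and sum_component: "\<xi> = (\<Sum>i\<in>{(p, q). p + q = m}. component \<xi> i)"
  using someI_ex[OF H_decompose, of \<xi>] unfolding component_def[symmetric] by blast+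

lemma component_H:
  assumes "p + q = m" "\<xi> \<in> H p q" "p' + q' = m"
  shows "component \<xi> (p', q') = (if p' = p then \<xi> else 0)"
proof -
  define x where "x i = component \<xi> i - (if i = (p, q) then \<xi> else 0)" for i
  have "x (a, b) \<in> H a b" if "a + b = m" for a b
    unfolding x_def using assms(1,2) that component_in[OF that]
    by (auto intro!: subspace_diff[OF subspace_H] subspace_0[OF subspace_H])
  moreover have "(\<Sum>i\<in>{(p, q). p + q = m}. x i) = 0"
    unfolding x_def sum_subtractf sum_component[symmetric]
    using finite_bidegrees assms(1) by (simp add: sum.delta)
  ultimately have "x (p', q') = 0" using H_independent[of x] assms(3) by blast
  then show ?thesis using assms(1,3) by (auto simp: x_def)
qed

lemma weil_rep_on_H:
  assumes "p + q = m" "\<xi> \<in> H p q" "w \<noteq> 0"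
  shows "weil_rep (Quat w 0) \<xi> = (w powi (- int p) * cnj w powi (- int q)) *s \<xi>"
    and "weil_rep quat_j \<xi> = (\<i> ^ (p + q)) *s F \<xi>"
    and "weil_rep (Quat w 0 * quat_j) \<eta> = weil_rep (Quat w 0) (weil_rep quat_j \<eta>)"
proof -
  have C: "weil_rep_C w \<xi> = (w powi (- int p) * cnj w powi (- int q)) *s \<xi>"
    if "p + q = m" "\<xi> \<in> H p q" for p q w \<xi>
  proof -
    have "weil_rep_C w \<xi> = (\<Sum>i\<in>{(p, q). p + q = m}. if i = (p, q)
            then (w powi (- int p) * cnj w powi (- int q)) *s \<xi> else 0)"
      unfolding weil_rep_C_def by (intro sum.cong refl) (use component_H[OF that] that(1) in \<open>auto split: if_splits\<close>)
    then show ?thesis using finite_bidegrees that by (simp add: sum.delta)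
  qed
  have F0: "F 0 = 0" using linear_F by (metis module_hom.zero linear_iff_module_hom)
  have "weil_rep_j \<xi> = (\<Sum>i\<in>{(p, q). p + q = m}. if i = (p, q) then (\<i> ^ (p + q)) *s F \<xi> else 0)"
    unfolding weil_rep_j_def
    by (intro sum.cong refl) (use component_H[OF assms(1,2)] assms(1) F0 in \<open>auto split: if_splits\<close>)
  then have j: "weil_rep_j \<xi> = (\<i> ^ (p + q)) *s F \<xi>"
    using finite_bidegrees assms by (simp add: sum.delta)
  have one: "weil_rep_C 1 \<zeta> = \<zeta>" for \<zeta>
    using sum_component[of \<zeta>] by (simp add: weil_rep_C_def case_prod_unfold)
  show "weil_rep (Quat w 0) \<xi> = (w powi (- int p) * cnj w powi (- int q)) *s \<xi>"
    using C assms by (simp add: weil_rep_def)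
  show "weil_rep quat_j \<xi> = (\<i> ^ (p + q)) *s F \<xi>"
    using j one by (simp add: weil_rep_def quat_j_def)
  show "weil_rep (Quat w 0 * quat_j) \<eta> = weil_rep (Quat w 0) (weil_rep quat_j \<eta>)"
    unfolding Quat_times_j using one assms(3) by (simp add: weil_rep_def quat_j_def)
qed

section \<open>The archimedean local factor\<close>

definition Gamma_C :: "complex \<Rightarrow> complex" where
  "Gamma_C z = complex_of_real (2 * pi) powr (- z) * Gamma z"

definition Gamma_R :: "complex \<Rightarrow> complex" where
  "Gamma_R z = complex_of_real (2 powr (- (1 / 2))) * complex_of_real pi powr (- z / 2) * Gamma (z / 2)"

definition L_R :: "complex \<Rightarrow> complex" where
  "L_R z = (\<Prod>(p, q)\<in>{(p, q). p < q \<and> p + q = m}. Gamma_C (z - of_nat p) ^ hodge_number p q) *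
           (\<Prod>p\<in>{p. 2 * p = m}. Gamma_R (z - of_nat p) ^ hodge_plus p *
                                Gamma_R (z - of_nat p + 1) ^ hodge_minus p)"

end

text \<open>A determination of $\log f$ along the vertical line $\Re z = \sigma$, as a function of
  $s = \Im z$.\<close>

definition log_branch_on_line :: "(complex \<Rightarrow> complex) \<Rightarrow> real \<Rightarrow> (real \<Rightarrow> complex) \<Rightarrow> bool" where
  "log_branch_on_line f \<sigma> l \<longleftrightarrow>
     continuous_on UNIV l \<and> (\<forall>s. exp (l s) = f (of_real \<sigma> + \<i> * of_real s))"

section \<open>Weil's principal value\<close>

definition mult_haar :: "real measure" where
  "mult_haar = density lborel (\<lambda>\<nu>. ennreal (indicator {0<..} \<nu> / \<nu>))"

definition f0 :: "real \<Rightarrow> real" where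
  "f0 \<nu> = min (\<nu> powr (1 / 2)) (\<nu> powr (- (1 / 2)))"

definition f1 :: "real \<Rightarrow> real" where
  "f1 \<nu> = inverse (f0 \<nu>) - f0 \<nu>"

text \<open>The fibre of the module over \<open>\<nu> > 0\<close> consists of the two circles $\sqrt\nu e^{i\theta}$ and
  $\sqrt\nu e^{i\theta} j$. Each of them has total mass $1/2$, whence the weight $1/(4\pi)$.\<close>

definition fibre_C :: "real \<Rightarrow> real \<Rightarrow> quaternion" where
  "fibre_C \<nu> \<theta> = Quat (of_real (sqrt \<nu>) * cis \<theta>) 0"

definition fibre_j :: "real \<Rightarrow> real \<Rightarrow> quaternion" where
  "fibre_j \<nu> \<theta> = Quat (of_real (sqrt \<nu>) * cis \<theta>) 0 * quat_j"

lemma fibre_eq: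
  assumes "\<nu> > 0"
  shows "{u \<in> weil_group. nrd u = \<nu>} = fibre_C \<nu> ` {0..<2*pi} \<union> fibre_j \<nu> ` {0..<2*pi}"
proof (intro equalityI subsetI)
  fix u assume "u \<in> {u \<in> weil_group. nrd u = \<nu>}"
  then obtain w where u: "u = Quat w 0 \<or> u = Quat w 0 * quat_j" and n: "(cmod w)\<^sup>2 = \<nu>"
    unfolding weil_group_def by (force simp only: Un_iff mem_Collect_eq nrd_simps)
  have "cmod w = sqrt \<nu>" using n by (metis norm_ge_zero real_sqrt_unique)
  then have w: "w = of_real (sqrt \<nu>) * cis (Arg2pi w)"
    using Arg2pi_eq[of w] by (simp add: cis_conv_exp)
  have v: "u = fibre_C \<nu> (Arg2pi w) \<or> u = fibre_j \<nu> (Arg2pi w)"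
    unfolding fibre_C_def fibre_j_def w[symmetric] using u .
  have "Arg2pi w \<in> {0..<2*pi}" using Arg2pi_ge_0 Arg2pi_lt_2pi by auto
  then show "u \<in> fibre_C \<nu> ` {0..<2*pi} \<union> fibre_j \<nu> ` {0..<2*pi}"
    using v by blast
next
  fix u assume "u \<in> fibre_C \<nu> ` {0..<2*pi} \<union> fibre_j \<nu> ` {0..<2*pi}"
  moreover have "of_real (sqrt \<nu>) * cis \<theta> \<noteq> 0" "(cmod (of_real (sqrt \<nu>) * cis \<theta>))\<^sup>2 = \<nu>" for \<theta>
    using assms by (simp_all add: norm_mult)
  ultimately show "u \<in> {u \<in> weil_group. nrd u = \<nu>}"
    unfolding fibre_C_def fibre_j_def weil_group_def by (auto simp: nrd_simps)
qed

definition fibre_integrable :: "(quaternion \<Rightarrow> complex) \<Rightarrow> real \<Rightarrow> bool" where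
  "fibre_integrable \<phi> \<nu> \<longleftrightarrow> set_integrable lborel {0..2*pi} (\<lambda>\<theta>. \<phi> (fibre_C \<nu> \<theta>)) \<and>
                           set_integrable lborel {0..2*pi} (\<lambda>\<theta>. \<phi> (fibre_j \<nu> \<theta>))"

definition fibre_integral :: "(quaternion \<Rightarrow> complex) \<Rightarrow> real \<Rightarrow> complex" where
  "fibre_integral \<phi> \<nu> = ((LINT \<theta>:{0..2*pi}|lborel. \<phi> (fibre_C \<nu> \<theta>)) +
                         (LINT \<theta>:{0..2*pi}|lborel. \<phi> (fibre_j \<nu> \<theta>))) / of_real (4 * pi)"

text \<open>The principal value of $\int_W \varphi$ exists and equals \<open>I\<close>. The constant \<open>c\<close> is unique
  because \<open>1 / f1\<close> is not integrable near \<open>1\<close>, so that \<open>I\<close> is unique as well. For \<open>t > 0\<close> the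
  integrand in the limit is integrable, since the factor \<open>1 - f0 powr (2 * t)\<close> vanishes at \<open>1\<close>.\<close>

definition has_weil_pv :: "(quaternion \<Rightarrow> complex) \<Rightarrow> complex \<Rightarrow> bool" where
  "has_weil_pv \<phi> I \<longleftrightarrow>
     (AE \<nu> in mult_haar. fibre_integrable \<phi> \<nu>) \<and>
     (\<exists>c. integrable mult_haar (\<lambda>\<nu>. fibre_integral \<phi> \<nu> - c * of_real (inverse (f1 \<nu>))) \<and>
          ((\<lambda>t. of_real (2 * ln (2 * pi)) * c +
                ((LINT \<nu>|mult_haar. of_real (1 - f0 \<nu> powr (2 * t)) * fibre_integral \<phi> \<nu>)
                 - 2 * c * of_real (ln t))) \<longlongrightarrow> I) at_top)"

end

theory Submission
  imports Defs "HOL-Complex_Analysis.Cauchy_Integral_Formula" "HOL-Real_Asymp.Real_Asymp"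
begin

text \<open>
  The principal value is computed fibre by fibre. On the circle $w = re^{i\theta}$ of the fibre over
  $\nu = r^2$ the summand $H^{p,q}$ contributes the character $e^{i(q-p)\theta}$, and its mean against
  $1/|1-w|^2$ is a Fourier coefficient of the Poisson kernel (\<open>poisson_kernel\<close>). On the circle $wj$
  only the $H^{p,p}$ contribute, through the trace of $F_\infty$, and the integrand is constant. In
  the variable $x = \log\nu$, which turns $d^*\nu$ into $dx$, the fibre integral at
  $z = \frac{1+m}{2}+is$ is therefore a combination, with Hodge numbers as coefficients, of the kernels
  \[ k_{a,b}(x) = \frac{b}{2}\,\frac{e^{-a|x|}}{1-e^{-b|x|}}\,e^{isx} \]
  (\<open>fibre_value_exp\<close>). A pair $p<q$ gives $2h^{p,q}$ times the kernel with $a = (q-p+1)/2$, $b = 1$.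
  For $2p=m$ the contributions of the two circles add up, on the two eigenspaces of $F_\infty$, to
  the kernels with $b = 2$ and $a = 1/2$ or $a = 3/2$; this replaces the duplication formula of the
  Gamma function.

  The principal value of $k_{a,b}$ is $\log 2\pi - \log b - \Re\,\Gamma'/\Gamma((a+is)/b)$
  (\<open>line_pv_kernel\<close>). When the cutoff parameter is $t = bN$, the quotient
  $(1-e^{-bN|x|})/(1-e^{-b|x|})$ is a finite geometric sum, so that the integral is exactly
  $\sum_{n<N}\Re\frac{1}{(a+is)/b+n}$. Its difference with $\log N$ tends to minus the real part of
  the digamma function at $(a+is)/b$ by Euler's limit formula, and $\log t - \log N = \log b$. For
  $t$ between $bN$ and $b(N+1)$ the integral moves by at most $b/(a+bN)$.

  On the other side, $\log L_{\mathbb{R}}$ has an explicit determination built from \<^const>\<open>ln_Gamma\<close>,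
  any other determination differs from it by a constant, and the derivative of its imaginary part is
  a sum of logarithms and of real parts of digamma values at the same points $(a+is)/b$, which is
  the sum above divided by $-2$ (\<open>log_branch_derivative\<close>).
\<close>

(* This notation would make the scalar multiplication of the vector space locales ambiguous. *)
no_notation vector_scalar_mult (infixl "*s" 70)

section \<open>Traces on direct sums\<close>

context finite_dimensional_vector_space
begin

lemma expansion_in_basis:
  assumes "independent B" "span B = UNIV"
  shows "v = (\<Sum>b\<in>B. representation B v b *s b)"
  using sum_representation_eq[of B v B] assms finiteI_independent by simp

lemma representation_sum_scale:
  assumes "independent B" "span B = UNIV"
  shows "representation B (\<Sum>i\<in>I. c i *s v i) b = (\<Sum>i\<in>I. c i * representation B (v i) b)"
  using assms by (simp add: representation_sum representation_scale)

text \<open>Expand each vector of \<open>A\<close> in \<open>B\<close>, exchange the two sums, and contract the expansion of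
  \<open>f b\<close> in \<open>A\<close> back.\<close>

lemma trace_basis_independent:
  assumes f: "Vector_Spaces.linear scale scale f"
    and A: "independent A" "span A = UNIV" and B: "independent B" "span B = UNIV"
  shows "(\<Sum>a\<in>A. representation A (f a) a) = (\<Sum>b\<in>B. representation B (f b) b)"
proof -
  interpret f: Vector_Spaces.linear scale scale f by fact
  have "(\<Sum>a\<in>A. representation A (f a) a)
      = (\<Sum>a\<in>A. \<Sum>b\<in>B. representation B a b * representation A (f b) a)"
  proof (rule sum.cong[OF refl])
    fix a
    have "f a = (\<Sum>b\<in>B. representation B a b *s f b)"
      by (subst (1) expansion_in_basis[OF B, of a]) (simp add: f.sum f.scale)
    then show "representation A (f a) a = (\<Sum>b\<in>B. representation B a b * representation A (f b) a)"
      by (simp add: representation_sum_scale[OF A])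
  qed
  also have "\<dots> = (\<Sum>b\<in>B. \<Sum>a\<in>A. representation A (f b) a * representation B a b)"
    by (subst sum.swap) (simp add: mult.commute)
  also have "\<dots> = (\<Sum>b\<in>B. representation B (f b) b)"
    by (intro sum.cong refl)
      (subst (2) expansion_in_basis[OF A], simp add: representation_sum_scale[OF B])
  finally show ?thesis .
qed

text \<open>The trace is read off in a basis adapted to the decomposition. The hypothesis on \<open>f\<close> says that
  its diagonal block on \<open>S i\<close> is the scalar \<open>c i\<close>; it covers both scalar action (the difference is
  \<open>0\<close>) and maps that move \<open>S i\<close> into another summand (with \<open>c i = 0\<close>), which are the two
  behaviours of the Weil group on a Hodge structure.\<close>

lemma trace_direct_sum:
  assumes f: "Vector_Spaces.linear scale scale f"
    and I: "finite I" and S: "\<And>i. i \<in> I \<Longrightarrow> subspace (S i)"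
    and spans: "\<And>v. \<exists>x. (\<forall>i\<in>I. x i \<in> S i) \<and> v = (\<Sum>i\<in>I. x i)"
    and indep: "\<And>x i. \<lbrakk>\<And>i. i \<in> I \<Longrightarrow> x i \<in> S i; (\<Sum>i\<in>I. x i) = 0; i \<in> I\<rbrakk> \<Longrightarrow> x i = 0"
    and diag: "\<And>i v. \<lbrakk>i \<in> I; v \<in> S i\<rbrakk> \<Longrightarrow> f v - c i *s v \<in> span (\<Union>k\<in>I - {i}. S k)"
  shows "(\<Sum>b\<in>Basis. representation Basis (f b) b) = (\<Sum>i\<in>I. of_nat (dim (S i)) * c i)"
proof -
  have "\<exists>B. \<forall>i\<in>I. B i \<subseteq> S i \<and> independent (B i) \<and> S i \<subseteq> span (B i) \<and> card (B i) = dim (S i)"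
    by (intro bchoice ballI) (metis basis_exists)
  then obtain B where B: "\<And>i. i \<in> I \<Longrightarrow> B i \<subseteq> S i" "\<And>i. i \<in> I \<Longrightarrow> independent (B i)"
    "\<And>i. i \<in> I \<Longrightarrow> S i \<subseteq> span (B i)" "\<And>i. i \<in> I \<Longrightarrow> card (B i) = dim (S i)"
    by blast
  have fin: "finite (B i)" if "i \<in> I" for i using B(2)[OF that] finiteI_independent by blast
  \<comment> \<open>A common basis vector \<open>b\<close> would give the relation \<open>b + (- b) = 0\<close> between two summands.\<close>
  have disj: "B i \<inter> B j = {}" if ij: "i \<in> I" "j \<in> I" "i \<noteq> j" for i j
  proof (rule ccontr)
    assume "B i \<inter> B j \<noteq> {}"
    then obtain b where b: "b \<in> B i" "b \<in> B j" by blast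
    define x where "x = (\<lambda>k. if k = i then b else if k = j then - b else 0)"
    have "x i = 0"
    proof (rule indep)
      show "x k \<in> S k" if "k \<in> I" for k
        using that b B(1) S ij by (auto simp: x_def intro: subspace_0 subspace_neg)
      have "(\<Sum>k\<in>I. x k) = (\<Sum>k\<in>{i,j}. x k)"
        using ij I by (intro sum.mono_neutral_right) (auto simp: x_def)
      then show "(\<Sum>k\<in>I. x k) = 0" using ij by (simp add: x_def)
    qed fact
    then have "b = 0" by (simp add: x_def)
    then show False using b B(2) ij dependent_zero by blast
  qed
  define U where "U = (\<Union>i\<in>I. B i)"
  have finU: "finite U" using fin I by (auto simp: U_def)
  have U_indep: "independent U"
  proof (rule independent_if_scalars_zero[OF finU])
    fix g b assume g: "(\<Sum>b\<in>U. g b *s b) = 0" and "b \<in> U"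
    then obtain i where i: "i \<in> I" "b \<in> B i" by (auto simp: U_def)
    have "(\<Sum>i\<in>I. \<Sum>b\<in>B i. g b *s b) = 0"
      unfolding g[symmetric] U_def using fin I disj by (subst sum.UNION_disjoint) auto
    moreover have "(\<Sum>b\<in>B k. g b *s b) \<in> S k" if "k \<in> I" for k
      using that B(1) by (intro subspace_sum subspace_scale S) auto
    ultimately have "(\<Sum>b\<in>B i. g b *s b) = 0"
      by (intro indep[where x = "\<lambda>i. \<Sum>b\<in>B i. g b *s b"] i)
    then show "g b = 0"
      using B(2)[OF i(1)] fin[OF i(1)] i independentD[of "B i" "B i" g b] by auto
  qed
  have U_span: "span U = UNIV"
  proof -
    have "v \<in> span U" for v
    proof -
      obtain x where x: "\<forall>i\<in>I. x i \<in> S i" "v = (\<Sum>i\<in>I. x i)" using spans by blast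
      have "x i \<in> span U" if "i \<in> I" for i
        using x(1) that B(3)[OF that] span_mono[of "B i" U] by (auto simp: U_def)
      then show ?thesis unfolding x(2) by (rule span_sum)
    qed
    then show ?thesis by blast
  qed
  have coeff: "representation U (f b) b = c i" if i: "i \<in> I" and b: "b \<in> B i" for i b
  proof -
    define v where "v = f b - c i *s b"
    have bU: "b \<in> U" using i b by (auto simp: U_def)
    have "(\<Union>k\<in>I - {i}. S k) \<subseteq> span (U - {b})"
    proof -
      have "S k \<subseteq> span (U - {b})" if k: "k \<in> I" "k \<noteq> i" for k
      proof -
        have "B k \<subseteq> U - {b}" using k disj[OF i k(1)] b by (auto simp: U_def)
        then show ?thesis using B(3)[OF k(1)] span_mono by blast
      qed
      then show ?thesis by blast
    qed
    then have "v \<in> span (U - {b})"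
      unfolding v_def using diag[OF i, of b] B(1)[OF i] b
      by (metis in_mono span_minimal subspace_span)
    then have "representation U v b = 0"
      using representation_extend[OF U_indep, of v "U - {b}"]
        representation_ne_zero[of "U - {b}" v b] by auto
    moreover have "f b = v + c i *s b" by (simp add: v_def)
    ultimately show ?thesis
      using U_indep U_span bU
      by (simp add: representation_add representation_scale representation_basis)
  qed
  have "(\<Sum>b\<in>Basis. representation Basis (f b) b) = (\<Sum>b\<in>U. representation U (f b) b)"
    by (intro trace_basis_independent f independent_Basis span_Basis U_indep U_span)
  also have "\<dots> = (\<Sum>i\<in>I. \<Sum>b\<in>B i. representation U (f b) b)"
    unfolding U_def using fin I disj by (subst sum.UNION_disjoint) auto
  also have "\<dots> = (\<Sum>i\<in>I. of_nat (dim (S i)) * c i)"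
    using coeff B(4) by (intro sum.cong refl) simp
  finally show ?thesis .
qed

end

section \<open>Traces of the Weil group representation\<close>

context real_hodge
begin

text \<open>The components of a vector are selected by a choice operator; they are linear in the vector
  because the decomposition is unique.\<close>

lemma linear_weil_rep_C: "Vector_Spaces.linear scale scale (weil_rep_C w)" (is ?C)
  and linear_weil_rep_j: "Vector_Spaces.linear scale scale weil_rep_j" (is ?j)
proof -
  interpret F: Vector_Spaces.linear scale scale F by (rule linear_F)
  have unique: "component \<xi> (p, q) = x (p, q)"
    if x: "\<And>p q. p + q = m \<Longrightarrow> x (p, q) \<in> H p q" and \<xi>: "\<xi> = (\<Sum>i\<in>{(p, q). p + q = m}. x i)"
      and pq: "p + q = m" for \<xi> x p q
  proof -
    have "component \<xi> (p, q) - x (p, q) = 0"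
    proof (rule H_independent[where x = "\<lambda>i. component \<xi> i - x i"])
      show "component \<xi> (p, q) - x (p, q) \<in> H p q" if "p + q = m" for p q
        using component_in[OF that] x[OF that] subspace_diff[OF subspace_H[OF that]] by blast
      show "(\<Sum>i\<in>{(p, q). p + q = m}. component \<xi> i - x i) = 0"
        using \<xi> sum_component[of \<xi>] by (simp add: sum_subtractf)
    qed (fact pq)
    then show ?thesis by simp
  qed
  have add': "component (\<xi> + \<eta>) (p, q) = component \<xi> (p, q) + component \<eta> (p, q)"
    if "p + q = m" for \<xi> \<eta> p q
  proof (rule unique[OF _ _ that])
    show "component \<xi> (p, q) + component \<eta> (p, q) \<in> H p q" if "p + q = m" for p q
      using component_in[OF that] subspace_add[OF subspace_H[OF that]] by blast
    show "\<xi> + \<eta> = (\<Sum>i\<in>{(p, q). p + q = m}. component \<xi> i + component \<eta> i)"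
      using sum_component[of \<xi>] sum_component[of \<eta>] by (simp add: sum.distrib)
  qed
  have scal': "component (c *s \<xi>) (p, q) = c *s component \<xi> (p, q)" if "p + q = m" for c \<xi> p q
  proof (rule unique[OF _ _ that])
    show "c *s component \<xi> (p, q) \<in> H p q" if "p + q = m" for p q
      using component_in[OF that] subspace_scale[OF subspace_H[OF that]] by blast
    show "c *s \<xi> = (\<Sum>i\<in>{(p, q). p + q = m}. c *s component \<xi> i)"
      using sum_component[of \<xi>] by (metis scale_sum_right)
  qed
  have add: "component (\<xi> + \<eta>) i = component \<xi> i + component \<eta> i"
    and scal: "component (c *s \<xi>) i = c *s component \<xi> i"
    if "fst i + snd i = m" for \<xi> \<eta> c i
    using add'[OF that] scal'[OF that] by simp_all
  show ?C
  proof (unfold_locales)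
    show "weil_rep_C w (\<xi> + \<eta>) = weil_rep_C w \<xi> + weil_rep_C w \<eta>" for \<xi> \<eta>
      unfolding weil_rep_C_def sum.distrib[symmetric]
      by (intro sum.cong refl) (simp add: add case_prod_unfold scale_right_distrib)
    show "weil_rep_C w (c *s \<xi>) = c *s weil_rep_C w \<xi>" for c \<xi>
      unfolding weil_rep_C_def scale_sum_right
      by (intro sum.cong refl) (simp add: scal case_prod_unfold mult_ac)
  qed
  show ?j
  proof (unfold_locales)
    show "weil_rep_j (\<xi> + \<eta>) = weil_rep_j \<xi> + weil_rep_j \<eta>" for \<xi> \<eta>
      unfolding weil_rep_j_def sum.distrib[symmetric]
      by (intro sum.cong refl) (simp add: add F.add case_prod_unfold scale_right_distrib)
    show "weil_rep_j (c *s \<xi>) = c *s weil_rep_j \<xi>" for c \<xi>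
      unfolding weil_rep_j_def scale_sum_right
      by (intro sum.cong refl) (simp add: scal F.scale case_prod_unfold mult_ac)
  qed
qed

lemma linear_weil_rep: "Vector_Spaces.linear scale scale (weil_rep u)"
proof (cases "jpart u = 0")
  case True
  then have "weil_rep u = weil_rep_C (cpart u)" by (auto simp: weil_rep_def)
  then show ?thesis using linear_weil_rep_C by simp
next
  case False
  then have "weil_rep u = weil_rep_C (jpart u) \<circ> weil_rep_j" by (auto simp: weil_rep_def)
  then show ?thesis using Vector_Spaces.linear_compose[OF linear_weil_rep_j linear_weil_rep_C] by simp
qed

text \<open>The involution \<open>F\<close> embeds each of the two summands into the other.\<close>

lemma hodge_number_sym:
  assumes "p + q = m"
  shows "hodge_number p q = hodge_number q p"
proof -
  have le: "dim (H p q) \<le> dim (H q p)" if "p + q = m" for p q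
  proof -
    interpret F: finite_dimensional_vector_space_pair scale Basis scale Basis ..
    have "inj_on F (span (H p q))"
      by (rule inj_on_inverseI[where g = F]) (simp add: F_involution)
    then have "dim (F ` H p q) = dim (H p q)"
      by (rule F.dim_image_eq[OF linear_F])
    moreover have "dim (F ` H p q) \<le> dim (H q p)"
      by (rule dim_subset[OF F_H[OF that]])
    ultimately show ?thesis by simp
  qed
  show ?thesis unfolding hodge_number_def using le[of p q] le[of q p] assms by simp
qed

text \<open>The decomposition in which all of the Weil group acts by scalars or by permuting summands: each
  \<open>H p p\<close> is split into the two eigenspaces of \<open>F\<close>, labelled by the Boolean, and the other \<open>H p q\<close>
  are kept whole, with the label \<open>True\<close>.\<close>

definition eigen_index :: "(nat \<times> nat \<times> bool) set" where
  "eigen_index = {(p, q, s). p + q = m \<and> (p \<noteq> q \<longrightarrow> s)}"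

definition eigen_summand :: "nat \<times> nat \<times> bool \<Rightarrow> 'v set" where
  "eigen_summand = (\<lambda>(p, q, s). if p = q
     then {\<xi> \<in> H p p. F \<xi> = (if s then (-1) ^ p else - ((-1) ^ p)) *s \<xi>} else H p q)"

lemma sum_eigen_index:
  fixes f :: "nat \<times> nat \<times> bool \<Rightarrow> 'b::comm_monoid_add"
  shows "(\<Sum>i\<in>eigen_index. f i)
    = (\<Sum>(p, q)\<in>{(p, q). p + q = m}. f (p, q, True) + (if p = q then f (p, q, False) else 0))"
proof -
  have "(\<Sum>i\<in>eigen_index. f i) = (\<Sum>(a, s)\<in>Sigma {(p, q). p + q = m}
          (\<lambda>(p, q). if p = q then UNIV else {True}). f (fst a, snd a, s))"
    by (rule sum.reindex_bij_witness[where i = "\<lambda>(a, s). (fst a, snd a, s)" and j = "\<lambda>(p, q, s). ((p, q), s)"])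
      (auto simp: eigen_index_def split: if_splits)
  also have "\<dots> = (\<Sum>a\<in>{(p, q). p + q = m}. \<Sum>s\<in>(if fst a = snd a then UNIV else {True}). f (fst a, snd a, s))"
    using finite_bidegrees
    by (subst sum.Sigma) (auto simp: case_prod_unfold intro!: sum.cong)
  also have "\<dots> = (\<Sum>(p, q)\<in>{(p, q). p + q = m}. f (p, q, True) + (if p = q then f (p, q, False) else 0))"
    by (intro sum.cong refl) (auto simp: UNIV_bool add.commute)
  finally show ?thesis .
qed

lemma sum_bidegrees_split:
  fixes f :: "nat \<times> nat \<Rightarrow> 'b::comm_monoid_add"
  shows "(\<Sum>i\<in>{(p, q). p + q = m}. f i)
    = (\<Sum>(p, q)\<in>{(p, q). p < q \<and> p + q = m}. f (p, q) + f (q, p)) + (\<Sum>p\<in>{p. 2 * p = m}. f (p, p))"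
proof -
  define A where "A = {(p, q). p + q = m}"
  have A: "i \<in> A \<longleftrightarrow> fst i + snd i = m" for i by (simp add: A_def case_prod_unfold)
  have fin: "finite A" unfolding A_def by (rule finite_bidegrees)
  let ?L = "{i. fst i < snd i}" and ?G = "{i. snd i < fst i}"
  have "sum f A = sum f (A \<inter> ?L) + (sum f ((A - ?L) \<inter> ?G) + sum f (A - ?L - ?G))"
    using fin by (simp add: sum.Int_Diff[of A f ?L] sum.Int_Diff[of "A - ?L" f ?G])
  also have "sum f ((A - ?L) \<inter> ?G) = (\<Sum>i\<in>A \<inter> ?L. f (prod.swap i))"
    by (rule sum.reindex_bij_witness[of _ prod.swap prod.swap]) (simp_all add: A add.commute)
  also have "sum f (A - ?L - ?G) = (\<Sum>p\<in>{p. 2 * p = m}. f (p, p))"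
    by (rule sum.reindex_bij_witness[of _ "\<lambda>p. (p, p)" fst]) (auto simp: A prod_eq_iff)
  also have "sum f (A \<inter> ?L) + ((\<Sum>i\<in>A \<inter> ?L. f (prod.swap i)) + (\<Sum>p\<in>{p. 2 * p = m}. f (p, p)))
      = (\<Sum>i\<in>A \<inter> ?L. f i + f (prod.swap i)) + (\<Sum>p\<in>{p. 2 * p = m}. f (p, p))"
    by (simp only: sum.distrib add.assoc)
  also have "(\<Sum>i\<in>A \<inter> ?L. f i + f (prod.swap i))
      = (\<Sum>(p, q)\<in>{(p, q). p < q \<and> p + q = m}. f (p, q) + f (q, p))"
    by (rule sum.cong) (auto simp: A)
  finally show ?thesis unfolding A_def .
qed

lemma finite_eigen_index: "finite eigen_index"
  by (rule finite_subset[of _ "{..m} \<times> {..m} \<times> UNIV"]) (auto simp: eigen_index_def)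

text \<open>The direct sum formula for the refined decomposition, with $H^{p,q}$ and $H^{q,p}$ grouped together
  (\<open>F\<close> exchanges them, so their dimensions agree). It is proved once for every \<open>u\<close>; the two
  circles of a fibre differ only in the scalars \<open>c\<close>.\<close>

lemma trace_weil_rep:
  assumes "\<And>p q s v. \<lbrakk>(p, q, s) \<in> eigen_index; v \<in> eigen_summand (p, q, s)\<rbrakk> \<Longrightarrow>
     weil_rep u v - c (p, q, s) *s v \<in> span (\<Union>k\<in>eigen_index - {(p, q, s)}. eigen_summand k)"
  shows "endo_trace (weil_rep u) =
     (\<Sum>(p, q)\<in>{(p, q). p < q \<and> p + q = m}. of_nat (hodge_number p q) * (c (p, q, True) + c (q, p, True)))
     + (\<Sum>p\<in>{p. 2 * p = m}. of_nat (hodge_plus p) * c (p, p, True) + of_nat (hodge_minus p) * c (p, p, False))"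
proof -
  interpret F: Vector_Spaces.linear scale scale F by (rule linear_F)
  \<comment> \<open>The sign \<open>sg p\<close> squares to \<open>1\<close>, so \<open>\<xi> \<plusminus> sg p *s F \<xi>\<close> are eigenvectors of \<open>F\<close>.\<close>
  define sg :: "nat \<Rightarrow> complex" where "sg = (\<lambda>p. (-1) ^ p)"
  have sg2: "sg p * sg p = 1" for p
    by (simp add: sg_def)
  have S: "subspace (eigen_summand i)" if "i \<in> eigen_index" for i
  proof -
    obtain p q s where i: "i = (p, q, s)" by (metis prod_cases3)
    have H: "subspace (H p q)" using that subspace_H by (auto simp: i eigen_index_def)
    show ?thesis
    proof (cases "p = q")
      case True
      define e where "e = (if s then (-1) ^ p else - ((-1 :: complex) ^ p))"
      have "subspace {\<xi> \<in> H p p. F \<xi> = e *s \<xi>}"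
      proof (rule subspaceI)
        fix \<xi> \<eta> and a :: complex
        assume \<xi>: "\<xi> \<in> {\<xi> \<in> H p p. F \<xi> = e *s \<xi>}"
        then show "a *s \<xi> \<in> {\<xi> \<in> H p p. F \<xi> = e *s \<xi>}"
          using H True by (simp add: F.scale subspace_scale mult.commute)
        assume "\<eta> \<in> {\<xi> \<in> H p p. F \<xi> = e *s \<xi>}"
        then show "\<xi> + \<eta> \<in> {\<xi> \<in> H p p. F \<xi> = e *s \<xi>}"
          using \<xi> H True by (simp add: F.add subspace_add scale_right_distrib)
      qed (use H True in \<open>simp add: F.zero subspace_0\<close>)
      then show ?thesis using True by (cases s) (simp_all add: i eigen_summand_def e_def)
    qed (use H in \<open>simp add: i eigen_summand_def\<close>)
  qed
  have "endo_trace (weil_rep u) = (\<Sum>i\<in>eigen_index. of_nat (dim (eigen_summand i)) * c i)"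
    unfolding endo_trace_def
  proof (rule trace_direct_sum[OF linear_weil_rep finite_eigen_index S])
    fix v
    define x where "x = (\<lambda>(p, q, s). if p \<noteq> q then component v (p, q)
        else (1/2) *s (component v (p, q) + (if s then sg p else - sg p) *s F (component v (p, q))))"
    have "x i \<in> eigen_summand i" if i: "i \<in> eigen_index" for i
    proof -
      obtain p q s where i': "i = (p, q, s)" by (metis prod_cases3)
      have pq: "p + q = m" using i by (auto simp: i' eigen_index_def)
      have c: "component v (p, q) \<in> H p q" by (rule component_in[OF pq])
      show ?thesis
      proof (cases "p = q")
        case True
        define e where "e = (if s then sg p else - sg p)"
        have e2: "e * e = 1" by (simp add: e_def sg2)
        have xi: "x i = (1/2) *s (component v (p, p) + e *s F (component v (p, p)))"
          by (simp add: x_def i' True e_def)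
        have "F (component v (p, p)) \<in> H p p" using F_H pq c True by blast
        moreover have "subspace (H p p)" using subspace_H pq True by blast
        ultimately have "x i \<in> H p p" using c unfolding xi True
          by (intro subspace_scale subspace_add) auto
        moreover have "F (x i) = e *s x i"
        proof -
          have "F (x i) = (1/2) *s (F (component v (p, p)) + e *s component v (p, p))"
            by (simp only: xi F.add F.scale F_involution)
          also have "\<dots> = (1/2) *s (e *s component v (p, p) + (e * e) *s F (component v (p, p)))"
            by (simp only: e2 scale_one add.commute)
          also have "\<dots> = e *s x i"
            unfolding xi by (simp only: scale_right_distrib scale_scale mult_ac)
          finally show ?thesis .
        qed
        ultimately show ?thesis
          by (simp add: i' eigen_summand_def True e_def sg_def split: if_splits)
      qed (use c in \<open>simp add: i' eigen_summand_def x_def\<close>)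
    qed
    moreover have "v = (\<Sum>i\<in>eigen_index. x i)"
    proof -
      have "x (p, q, True) + (if p = q then x (p, q, False) else 0) = component v (p, q)" for p q
      proof (cases "p = q")
        case True
        have "(1/2) *s component v (p, q) + (1/2) *s component v (p, q) = component v (p, q)"
          using scale_left_distrib[of "1/2" "1/2" "component v (p, q)"] by simp
        then show ?thesis using True by (simp add: x_def scale_right_distrib)
      qed (simp add: x_def)
      then show ?thesis using sum_component[of v] by (simp add: sum_eigen_index case_prod_unfold)
    qed
    ultimately show "\<exists>x. (\<forall>i\<in>eigen_index. x i \<in> eigen_summand i) \<and> v = (\<Sum>i\<in>eigen_index. x i)"
      by blast
  next
    fix x i assume x: "\<And>i. i \<in> eigen_index \<Longrightarrow> x i \<in> eigen_summand i"
      and sum: "(\<Sum>i\<in>eigen_index. x i) = 0" and i: "i \<in> eigen_index"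
    obtain p q s where i': "i = (p, q, s)" by (metis prod_cases3)
    have pq: "p + q = m" using i by (auto simp: i' eigen_index_def)
    define y where "y = (\<lambda>(p, q). x (p, q, True) + (if p = q then x (p, q, False) else 0))"
    have "y (p, q) = 0"
    proof (rule H_independent[OF _ _ pq])
      show "y (p, q) \<in> H p q" if "p + q = m" for p q
        using x[of "(p, q, True)"] x[of "(p, q, False)"] that subspace_add[OF subspace_H[OF that]]
        by (auto simp: y_def eigen_index_def eigen_summand_def split: if_splits)
      show "(\<Sum>i\<in>{(p, q). p + q = m}. y i) = 0"
        using sum by (simp add: sum_eigen_index y_def)
    qed
    show "x i = 0"
    proof (cases "p = q")
      case False
      then show ?thesis using \<open>y (p, q) = 0\<close> i by (auto simp: y_def i' eigen_index_def)
    next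
      case True
      have 1: "x (p, p, True) = - x (p, p, False)"
        using \<open>y (p, q) = 0\<close> True by (simp add: y_def eq_neg_iff_add_eq_0)
      have "F (x (p, p, True)) = sg p *s x (p, p, True)"
        "F (x (p, p, False)) = - (sg p *s x (p, p, False))"
        using x[of "(p, p, True)"] x[of "(p, p, False)"] pq True
        by (auto simp: eigen_index_def eigen_summand_def sg_def)
      then have "sg p *s x (p, p, False) = - (sg p *s x (p, p, False))"
        by (simp add: 1 F.neg)
      then have "sg p *s sg p *s x (p, p, False) = - (sg p *s sg p *s x (p, p, False))"
        by (metis scale_minus_right)
      then have "x (p, p, False) = - x (p, p, False)"
        by (simp add: sg2)
      then have "2 *s x (p, p, False) = 0"
        using scale_left_distrib[of 1 1 "x (p, p, False)"] by (simp add: eq_neg_iff_add_eq_0)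
      then have "x (p, p, False) = 0" by simp
      then show ?thesis using 1 True by (cases s) (auto simp: i')
    qed
  next
    fix i v assume "i \<in> eigen_index" "v \<in> eigen_summand i"
    then show "weil_rep u v - c i *s v \<in> span (\<Union>k\<in>eigen_index - {i}. eigen_summand k)"
      using assms by (metis prod_cases3)
  qed
  also have "\<dots> = (\<Sum>(p, q)\<in>{(p, q). p < q \<and> p + q = m}.
        of_nat (hodge_number p q) * (c (p, q, True) + c (q, p, True)))
     + (\<Sum>p\<in>{p. 2 * p = m}. of_nat (hodge_plus p) * c (p, p, True) + of_nat (hodge_minus p) * c (p, p, False))"
    unfolding sum_eigen_index sum_bidegrees_split
  proof (intro arg_cong2[where f = "(+)"] sum.cong refl, goal_cases)
    case (1 a)
    then obtain p q where a: "a = (p, q)" "p < q" "p + q = m" by auto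
    then have "dim (H q p) = hodge_number p q"
      using hodge_number_sym[OF a(3)] by (simp add: hodge_number_def)
    then show ?case using a by (simp add: eigen_summand_def hodge_number_def distrib_left)
  next
    case (2 p)
    then show ?case by (simp add: eigen_summand_def hodge_plus_def hodge_minus_def)
  qed
  finally show ?thesis .
qed

lemma trace_weil_rep_C:
  assumes w: "w \<noteq> 0"
  shows "endo_trace (weil_rep (Quat w 0)) =
     (\<Sum>(p, q)\<in>{(p, q). p < q \<and> p + q = m}. of_nat (hodge_number p q)
        * (w powi (- int p) * cnj w powi (- int q) + w powi (- int q) * cnj w powi (- int p)))
     + (\<Sum>p\<in>{p. 2 * p = m}. (of_nat (hodge_plus p) + of_nat (hodge_minus p))
        * (w powi (- int p) * cnj w powi (- int p)))"
proof -
  define c where "c = (\<lambda>(p :: nat, q :: nat, s :: bool). w powi (- int p) * cnj w powi (- int q))"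
  have "weil_rep (Quat w 0) v - c (p, q, s) *s v = 0"
    if "(p, q, s) \<in> eigen_index" "v \<in> eigen_summand (p, q, s)" for p q s v
  proof -
    have "p + q = m" "v \<in> H p q"
      using that by (auto simp: eigen_index_def eigen_summand_def split: if_splits)
    from weil_rep_on_H(1)[OF this w] show ?thesis by (simp add: c_def)
  qed
  then show ?thesis
    using trace_weil_rep[where c = c and u = "Quat w 0"]
    unfolding c_def by (simp only: prod.case span_zero distrib_right)
qed

text \<open>The factor $i^{p+q}$ equals $(-1)^p$ on $H^{p,p}$ and cancels the sign in the definition of
  $h^{p,\pm}$. For $p \neq q$ the summand $H^{p,q}$ is moved to $H^{q,p}$ and does not contribute.\<close>

lemma trace_weil_rep_j:
  assumes w: "w \<noteq> 0"
  shows "endo_trace (weil_rep (Quat w 0 * quat_j)) =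
     (\<Sum>p\<in>{p. 2 * p = m}. (of_nat (hodge_plus p) - of_nat (hodge_minus p))
        * (w powi (- int p) * cnj w powi (- int p)))"
proof -
  define c where "c = (\<lambda>(p::nat, q, s). if p = q
     then (if s then 1 else -1) * (w powi (- int p) * cnj w powi (- int p)) else 0)"
  have "weil_rep (Quat w 0 * quat_j) v - c (p, q, s) *s v
      \<in> span (\<Union>k\<in>eigen_index - {(p, q, s)}. eigen_summand k)"
    if i: "(p, q, s) \<in> eigen_index" and v: "v \<in> eigen_summand (p, q, s)" for p q s v
  proof -
    have pq: "p + q = m" and vH: "v \<in> H p q"
      using i v by (auto simp: eigen_index_def eigen_summand_def split: if_splits)
    have qp: "q + p = m" using pq by simp
    have Fv: "F v \<in> H q p" using F_H[OF pq] vH by blast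
    have iFv: "(\<i> ^ (p + q)) *s F v \<in> H q p" by (rule subspace_scale[OF subspace_H[OF qp] Fv])
    have r: "weil_rep (Quat w 0 * quat_j) v
        = (w powi (- int q) * cnj w powi (- int p) * \<i> ^ (p + q)) *s F v"
      unfolding weil_rep_on_H(3)[OF pq vH w] weil_rep_on_H(2)[OF pq vH w]
        weil_rep_on_H(1)[OF qp iFv w] by simp
    show ?thesis
    proof (cases "p = q")
      case False
      then have "F v \<in> eigen_summand (q, p, True)" "(q, p, True) \<in> eigen_index - {(p, q, s)}"
        using Fv qp by (auto simp: eigen_summand_def eigen_index_def)
      then have "F v \<in> span (\<Union>k\<in>eigen_index - {(p, q, s)}. eigen_summand k)"
        by (intro span_base) blast
      then show ?thesis unfolding r c_def using False by (simp add: span_scale)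
    next
      case True
      have "F v = ((if s then 1 else -1) * (-1) ^ p) *s v"
        using v True by (auto simp: eigen_summand_def split: if_splits)
      moreover have i2p: "\<i> ^ (p + q) = (-1) ^ p"
        using power_mult[of "\<i>" 2 p] True by (simp add: mult_2)
      ultimately have "weil_rep (Quat w 0 * quat_j) v
          = (w powi (- int p) * cnj w powi (- int p) * ((-1) ^ p * ((if s then 1 else -1) * (-1) ^ p))) *s v"
        unfolding r using True by (simp only: i2p scale_scale mult.assoc)
      also have "(-1) ^ p * ((if s then 1 else -1) * (-1) ^ p) = (if s then 1 else -1 :: complex)"
        by simp
      finally have "weil_rep (Quat w 0 * quat_j) v = c (p, q, s) *s v"
        using True by (simp add: c_def mult.commute)
      then show ?thesis by (simp add: span_zero)
    qed
  qed
  then have "endo_trace (weil_rep (Quat w 0 * quat_j)) =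
     (\<Sum>(p, q)\<in>{(p, q). p < q \<and> p + q = m}. of_nat (hodge_number p q) * (c (p, q, True) + c (q, p, True)))
     + (\<Sum>p\<in>{p. 2 * p = m}. of_nat (hodge_plus p) * c (p, p, True) + of_nat (hodge_minus p) * c (p, p, False))"
    by (rule trace_weil_rep)
  also have "(\<Sum>(p, q)\<in>{(p, q). p < q \<and> p + q = m}.
      of_nat (hodge_number p q) * (c (p, q, True) + c (q, p, True))) = 0"
    by (rule sum.neutral) (auto simp: c_def)
  finally show ?thesis by (simp add: c_def left_diff_distrib)
qed

end

section \<open>Fourier coefficients of the Poisson kernel\<close>

lemma cmod_one_minus_cis_sq:
  "complex_of_real ((cmod (1 - of_real r * cis \<theta>))\<^sup>2) * cis \<theta> = (1 - of_real r * cis \<theta>) * (cis \<theta> - of_real r)"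
proof -
  have "complex_of_real ((cmod (1 - of_real r * cis \<theta>))\<^sup>2) = (1 - of_real r * cis \<theta>) * (1 - of_real r * cis (- \<theta>))"
    by (simp only: complex_norm_square) (simp add: cis_cnj)
  moreover have "(1 - of_real r * cis (- \<theta>)) * cis \<theta> = cis \<theta> - of_real r"
    by (simp add: left_diff_distrib mult.assoc cis_mult)
  ultimately show ?thesis by (simp only: mult.assoc)
qed

lemma one_minus_cis_nonzero:
  assumes "\<bar>r\<bar> \<noteq> 1"
  shows "1 - of_real r * cis \<theta> \<noteq> 0"
proof
  assume "1 - of_real r * cis \<theta> = 0"
  then have "cmod (of_real r * cis \<theta>) = cmod 1" by simp
  then show False using assms by (simp add: norm_mult)
qed

text \<open>On the unit circle $|1-re^{i\theta}|^2 e^{i\theta} = (1-re^{i\theta})(e^{i\theta}-r)$, so the integral is the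
  Cauchy integral at $r$ of the function $z^n/(1-rz)$.\<close>

lemma poisson_kernel_nat:
  assumes r: "\<bar>r\<bar> < 1"
  shows "((\<lambda>\<theta>. cis (of_nat n * \<theta>) / of_real ((cmod (1 - of_real r * cis \<theta>))\<^sup>2))
           has_integral of_real (2 * pi * r ^ n / (1 - r\<^sup>2))) {0..2*pi}"
proof -
  have cancel_i: "(x * \<i> * y) / \<i> = x * y" for x y by (simp add: complex_eq_iff)
  define f where "f z = z ^ n / (1 - of_real r * z)" for z :: complex
  have nz: "1 - of_real r * z \<noteq> 0" if "cmod z \<le> 1" for z
  proof
    assume "1 - of_real r * z = 0"
    then have "cmod (of_real r * z) = cmod 1" by simp
    then have "\<bar>r\<bar> * cmod z = 1" by (simp add: norm_mult)
    moreover have "\<bar>r\<bar> * cmod z \<le> \<bar>r\<bar>" using that by (simp add: mult_left_le)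
    ultimately show False using r by simp
  qed
  have "f holomorphic_on cball 0 1"
    unfolding f_def by (intro holomorphic_intros) (use nz in auto)
  then have "((\<lambda>u. f u / (u - of_real r)) has_contour_integral (2 * of_real pi * \<i> * f (of_real r)))
      (circlepath 0 1)"
    by (rule Cauchy_integral_circlepath_simple) (use r in simp)
  then have "((\<lambda>\<theta>. f (cis \<theta>) / (cis \<theta> - of_real r) * \<i> * cis \<theta>)
      has_integral (2 * of_real pi * \<i> * f (of_real r))) {0..2*pi}"
    unfolding circlepath_def by (subst (asm) has_contour_integral_part_circlepath_iff) simp_all
  then have "((\<lambda>\<theta>. (f (cis \<theta>) / (cis \<theta> - of_real r) * \<i> * cis \<theta>) / \<i>)
      has_integral (2 * of_real pi * \<i> * f (of_real r)) / \<i>) {0..2*pi}"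
    by (rule has_integral_divide)
  moreover have "(f (cis \<theta>) / (cis \<theta> - of_real r) * \<i> * cis \<theta>) / \<i>
      = cis (of_nat n * \<theta>) / of_real ((cmod (1 - of_real r * cis \<theta>))\<^sup>2)" for \<theta>
  proof -
    define N where "N = complex_of_real ((cmod (1 - of_real r * cis \<theta>))\<^sup>2)"
    have N: "N * cis \<theta> = (1 - of_real r * cis \<theta>) * (cis \<theta> - of_real r)"
      unfolding N_def by (rule cmod_one_minus_cis_sq)
    have 1: "N \<noteq> 0" using nz[of "cis \<theta>"] by (simp add: N_def)
    then have 2: "(1 - of_real r * cis \<theta>) * (cis \<theta> - of_real r) \<noteq> 0"
      unfolding N[symmetric] by simp
    have "(f (cis \<theta>) / (cis \<theta> - of_real r) * \<i> * cis \<theta>) / \<i>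
        = cis \<theta> ^ n * cis \<theta> / ((1 - of_real r * cis \<theta>) * (cis \<theta> - of_real r))"
      unfolding cancel_i by (simp add: f_def)
    also have "\<dots> = cis \<theta> ^ n / N"
      unfolding N[symmetric] by simp
    finally show ?thesis unfolding N_def Complex.DeMoivre .
  qed
  moreover have "(2 * of_real pi * \<i> * f (of_real r)) / \<i> = of_real (2 * pi * r ^ n / (1 - r\<^sup>2))"
    unfolding cancel_i by (simp add: f_def power2_eq_square)
  ultimately show ?thesis by (simp only:)
qed

lemma poisson_kernel_int:
  assumes r: "\<bar>r\<bar> < 1"
  shows "((\<lambda>\<theta>. cis (of_int k * \<theta>) / of_real ((cmod (1 - of_real r * cis \<theta>))\<^sup>2))
           has_integral of_real (2 * pi * r ^ nat \<bar>k\<bar> / (1 - r\<^sup>2))) {0..2*pi}"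
proof (cases "k \<ge> 0")
  case True
  then show ?thesis using poisson_kernel_nat[OF r, of "nat k"] by simp
next
  case False
  have "((\<lambda>\<theta>. cnj (cis (of_nat (nat (- k)) * \<theta>) / of_real ((cmod (1 - of_real r * cis \<theta>))\<^sup>2)))
           has_integral cnj (of_real (2 * pi * r ^ nat (- k) / (1 - r\<^sup>2)))) {0..2*pi}"
    using poisson_kernel_nat[OF r, of "nat (- k)"]
    by (subst (asm) has_integral_cnj[symmetric]) (simp only: o_def)
  then show ?thesis using False by (simp add: cis_cnj)
qed

text \<open>The \<open>n\<close>-th Fourier coefficient of $1/|1-re^{i\theta}|^2$, inside and outside the unit circle.\<close>

definition poisson_coeff :: "real \<Rightarrow> nat \<Rightarrow> real" where
  "poisson_coeff r n = (if \<bar>r\<bar> < 1 then r ^ n / (1 - r\<^sup>2) else inverse r ^ n / (r\<^sup>2 - 1))"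

text \<open>Outside the unit disc, $|1-re^{i\theta}| = |r|\,|1-r^{-1}e^{i\theta}|$ for real $r$. Negative radii are
  included because the fibre integral is also evaluated at negative \<open>\<nu>\<close>, where its measurability is
  still required.\<close>

lemma poisson_kernel:
  assumes r: "\<bar>r\<bar> \<noteq> 1"
  shows "((\<lambda>\<theta>. cis (of_int k * \<theta>) / of_real ((cmod (1 - of_real r * cis \<theta>))\<^sup>2))
           has_integral of_real (2 * pi * poisson_coeff r (nat \<bar>k\<bar>))) {0..2*pi}"
proof (cases "\<bar>r\<bar> < 1")
  case True
  then show ?thesis using poisson_kernel_int[OF True, of k] by (simp add: poisson_coeff_def)
next
  case False
  then have r1: "\<bar>r\<bar> > 1" using r by simp
  then have r0: "r \<noteq> 0" by auto
  have ir: "\<bar>inverse r\<bar> < 1" using r1 by (simp add: inverse_less_1_iff abs_inverse)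
  have eq: "(cmod (1 - of_real r * cis \<theta>))\<^sup>2 = r\<^sup>2 * (cmod (1 - of_real (inverse r) * cis \<theta>))\<^sup>2" for \<theta>
  proof -
    have "(cmod (1 - of_real x * cis \<theta>))\<^sup>2 = 1 - 2 * x * cos \<theta> + x\<^sup>2" for x
    proof -
      have "(x * cos \<theta>)\<^sup>2 + (x * sin \<theta>)\<^sup>2 = x\<^sup>2"
        by (simp add: power_mult_distrib flip: distrib_left)
      then show ?thesis by (simp add: cmod_power2 power2_diff)
    qed
    then show ?thesis using r0 by (simp only:) (simp add: field_simps power2_eq_square)
  qed
  have "((\<lambda>\<theta>. (cis (of_int k * \<theta>) / of_real ((cmod (1 - of_real (inverse r) * cis \<theta>))\<^sup>2)) / of_real (r\<^sup>2))
           has_integral of_real (2 * pi * inverse r ^ nat \<bar>k\<bar> / (1 - (inverse r)\<^sup>2)) / of_real (r\<^sup>2)) {0..2*pi}"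
    by (intro has_integral_divide poisson_kernel_int ir)
  moreover have "of_real (2 * pi * inverse r ^ nat \<bar>k\<bar> / (1 - (inverse r)\<^sup>2)) / of_real (r\<^sup>2)
      = (of_real (2 * pi * poisson_coeff r (nat \<bar>k\<bar>)) :: complex)"
  proof -
    have "(1 - (inverse r)\<^sup>2) * r\<^sup>2 = r\<^sup>2 - 1"
      using r0 by (simp add: left_diff_distrib power_inverse)
    then show ?thesis using False
      unfolding poisson_coeff_def of_real_divide[symmetric] divide_divide_eq_left by simp
  qed
  ultimately show ?thesis
    unfolding eq by (simp only: divide_divide_eq_left of_real_mult mult.commute[of "of_real (r\<^sup>2)"])
qed

section \<open>Haar measure and Laplace integrals in the logarithmic variable\<close>

text \<open>Both measures are exhausted by the intervals $[e^{-n}, e^n]$, on which this is the substitution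
  $\nu = e^x$.\<close>

lemma mult_haar_eq_distr_exp: "mult_haar = distr lborel borel exp"
proof (rule measure_eqI)
  show "sets mult_haar = sets (distr lborel borel exp)"
    by (simp add: mult_haar_def)
  fix A assume "A \<in> sets mult_haar"
  then have A[measurable]: "A \<in> sets borel" by (simp add: mult_haar_def)
  define f :: "real \<Rightarrow> real" where "f y = indicator A y * indicator {0<..} y / y" for y
  have [measurable]: "f \<in> borel_measurable borel" unfolding f_def by measurable
  have "emeasure mult_haar A = (\<integral>\<^sup>+y. ennreal (f y) * indicator {0<..} y \<partial>lborel)"
    unfolding mult_haar_def
    by (subst emeasure_density) (auto simp: f_def indicator_def intro!: nn_integral_cong)
  also have "\<dots> = (SUP n. \<integral>\<^sup>+y. ennreal (f y) * indicator {exp (- real n)..exp (real n)} y \<partial>lborel)"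
  proof (subst nn_integral_monotone_convergence_SUP[symmetric])
    show "incseq (\<lambda>n y. ennreal (f y) * indicator {exp (- real n)..exp (real n)} y)"
    proof (intro incseq_SucI le_funI mult_left_mono)
      fix n y
      show "indicator {exp (- real n)..exp (real n)} y
          \<le> (indicator {exp (- real (Suc n))..exp (real (Suc n))} y :: ennreal)"
        by (rule indicator_leI) (auto intro: order_trans[rotated] order_trans[of _ "exp (- real n)"] order_trans[of _ "exp (real n)"])
    qed auto
    have "(SUP n. ennreal (f y) * indicator {exp (- real n)..exp (real n)} y)
        = ennreal (f y) * indicator {0<..} y" for y
    proof (cases "y > 0")
      case True
      obtain n where n: "\<bar>ln y\<bar> \<le> real n" using real_arch_simple by blast
      have "y \<in> {exp (- real n)..exp (real n)}"
        using n True by (auto simp: abs_le_iff ln_ge_iff[symmetric] ln_le_cancel_iff[of y "exp (real n)", symmetric])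
      then have "ennreal (f y) \<le> (SUP n. ennreal (f y) * indicator {exp (- real n)..exp (real n)} y)"
        by (intro SUP_upper2[of n]) auto
      moreover have "(SUP n. ennreal (f y) * indicator {exp (- real n)..exp (real n)} y) \<le> ennreal (f y)"
        by (intro SUP_least) (auto simp: indicator_def)
      ultimately show ?thesis using True by (simp add: antisym)
    next
      case False
      then have "y \<notin> {exp (- real n)..exp (real n)}" for n
        by (auto dest: order.strict_trans2[OF exp_gt_zero])
      then show ?thesis using False by simp
    qed
    then show "(\<integral>\<^sup>+y. ennreal (f y) * indicator {0<..} y \<partial>lborel)
      = (\<integral>\<^sup>+y. (SUP n. ennreal (f y) * indicator {exp (- real n)..exp (real n)} y) \<partial>lborel)"
      by simp
  qed auto
  also have "\<dots> = (SUP n. \<integral>\<^sup>+x. indicator (exp -` A) x * indicator {- real n..real n} x \<partial>lborel)"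
  proof (intro SUP_cong refl)
    fix n
    have "(\<integral>\<^sup>+y. ennreal (f y) * indicator {exp (- real n)..exp (real n)} y \<partial>lborel)
        = (\<integral>\<^sup>+y. ennreal (f y * indicator {exp (- real n)..exp (real n)} y) \<partial>lborel)"
      by (intro nn_integral_cong) (auto simp: indicator_def)
    also have "\<dots> = (\<integral>\<^sup>+x. ennreal (f (exp x) * exp x * indicator {- real n..real n} x) \<partial>lborel)"
      by (rule nn_integral_substitution) (auto simp: set_borel_measurable_def intro!: derivative_eq_intros continuous_intros)
    also have "\<dots> = (\<integral>\<^sup>+x. indicator (exp -` A) x * indicator {- real n..real n} x \<partial>lborel)"
      by (intro nn_integral_cong) (auto simp: indicator_def f_def)
    finally show "(\<integral>\<^sup>+y. ennreal (f y) * indicator {exp (- real n)..exp (real n)} y \<partial>lborel)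
        = (\<integral>\<^sup>+x. indicator (exp -` A) x * indicator {- real n..real n} x \<partial>lborel)" .
  qed
  also have "\<dots> = (\<integral>\<^sup>+x. indicator (exp -` A) x \<partial>lborel)"
  proof (subst nn_integral_monotone_convergence_SUP[symmetric])
    have [measurable]: "exp -` A \<in> sets lborel"
      using measurable_sets[of exp lborel borel A] A by simp
    show "(\<lambda>x. indicator (exp -` A) x * indicator {- real n..real n} x :: ennreal)
        \<in> borel_measurable lborel" for n
      by measurable
    show "incseq (\<lambda>n x. indicator (exp -` A) x * indicator {- real n..real n} x :: ennreal)"
      by (intro incseq_SucI le_funI mult_left_mono indicator_leI) auto
    have "(SUP n. indicator (exp -` A) x * indicator {- real n..real n} x) = (indicator (exp -` A) x :: ennreal)" for x
    proof -
      obtain n where n: "\<bar>x\<bar> \<le> real n" using real_arch_simple by blast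
      have "indicator (exp -` A) x \<le> (SUP n. indicator (exp -` A) x * indicator {- real n..real n} x :: ennreal)"
        using n by (intro SUP_upper2[of n]) (auto simp: abs_le_iff)
      moreover have "(SUP n. indicator (exp -` A) x * indicator {- real n..real n} x) \<le> (indicator (exp -` A) x :: ennreal)"
        by (intro SUP_least) (auto simp: indicator_def)
      ultimately show ?thesis by (simp add: antisym)
    qed
    then show "(\<integral>\<^sup>+x. (SUP n. indicator (exp -` A) x * indicator {- real n..real n} x) \<partial>lborel)
      = (\<integral>\<^sup>+x. indicator (exp -` A) x \<partial>lborel)" by simp
  qed
  also have "\<dots> = emeasure (distr lborel borel exp) A"
    using A measurable_sets[of exp lborel borel A] by (simp add: emeasure_distr)
  finally show "emeasure mult_haar A = emeasure (distr lborel borel exp) A" .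
qed

lemma laplace_half_line:
  fixes c :: complex
  assumes c: "Re c > 0"
  shows "has_bochner_integral lborel (\<lambda>x. indicator {0<..} x *\<^sub>R exp (- c * of_real x)) (1 / c)"
proof -
  have c0: "c \<noteq> 0" using c by auto
  have "((\<lambda>x. exp (- Re c * x)) has_integral exp (- Re c * 0) / Re c) {0..}"
    by (rule has_integral_exp_minus_to_infinity[OF c])
  then have "set_integrable lebesgue {0..} (\<lambda>x. exp (- Re c * x))"
    by (intro nonnegative_absolutely_integrable_1) (auto simp: integrable_on_def)
  then have "set_integrable lborel {0..} (\<lambda>x. exp (- Re c * x))"
    unfolding set_integrable_def by (subst (asm) integrable_completion) auto
  then have "set_integrable lborel {0<..} (\<lambda>x. exp (- Re c * x))"
    by (rule set_integrable_subset) auto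
  then have int: "set_integrable lborel {0<..} (\<lambda>x. exp (- c * complex_of_real x))"
    unfolding set_integrable_def
    by (rule Bochner_Integration.integrable_bound) (auto simp: norm_mult)
  have "(LBINT x=0..\<infinity>. exp (- c * of_real x)) = 0 - (- 1 / c)"
  proof (rule interval_integral_FTC_integrable)
    let ?F = "\<lambda>x. - exp (- c * complex_of_real x) / c"
    show "(?F has_vector_derivative exp (- c * of_real x)) (at x)" for x
      using c0 by (auto intro!: derivative_eq_intros has_vector_derivative_real_field)
    show "isCont (\<lambda>x. exp (- c * complex_of_real x)) x" for x
      by (intro continuous_intros)
    show "set_integrable lborel (einterval 0 \<infinity>) (\<lambda>x. exp (- c * complex_of_real x))"
      using int by (simp add: einterval_eq zero_ereal_def)
    have "isCont ?F 0" using c0 by (intro continuous_intros)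
    then have "(?F \<longlongrightarrow> ?F 0) (at_right 0)"
      unfolding isCont_def by (rule filterlim_mono) (auto simp: at_le)
    then show "((?F \<circ> real_of_ereal) \<longlongrightarrow> - 1 / c) (at_right 0)"
      unfolding zero_ereal_def ereal_tendsto_simps by simp
    have "((\<lambda>x. exp (- Re c * x) / cmod c) \<longlongrightarrow> 0) at_top"
      using c c0 by real_asymp
    then have "(?F \<longlongrightarrow> 0) at_top"
      by (rule Lim_null_comparison[rotated]) (auto simp: norm_divide)
    then show "((?F \<circ> real_of_ereal) \<longlongrightarrow> 0) (at_left \<infinity>)"
      unfolding ereal_tendsto_simps .
  qed auto
  then have "(LINT x:{0<..}|lborel. exp (- c * of_real x)) = 1 / c"
    by (simp add: interval_lebesgue_integral_0_infty)
  then show ?thesis using int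
    by (simp add: has_bochner_integral_iff set_integrable_def set_lebesgue_integral_def)
qed

text \<open>Fold the line at the origin: the two halves are complex conjugate Laplace integrals.\<close>

lemma laplace_line:
  assumes a: "a > 0"
  shows "has_bochner_integral lborel (\<lambda>x. exp (\<i> * of_real (s * x) - of_real (a * \<bar>x\<bar>)))
           (of_real (2 * Re (1 / (of_real a + \<i> * of_real s))))"
proof -
  let ?c = "of_real a + \<i> * of_real s"
  have 1: "has_bochner_integral lborel (\<lambda>x. indicator {0<..} x *\<^sub>R exp (- cnj ?c * of_real x)) (1 / cnj ?c)"
    using a by (intro laplace_half_line) auto
  have "has_bochner_integral lborel (\<lambda>x. indicator {0<..} x *\<^sub>R exp (- ?c * of_real x)) (1 / ?c)"
    using a by (intro laplace_half_line) auto
  then have 2: "has_bochner_integral lborel (\<lambda>x. indicator {0<..} (0 + -1 * x) *\<^sub>R exp (- ?c * of_real (0 + -1 * x)))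
      ((1 / ?c) /\<^sub>R \<bar>-1\<bar>)"
    by (subst lborel_has_bochner_integral_real_affine_iff[symmetric]) auto
  have "has_bochner_integral lborel (\<lambda>x. indicator {0<..} x *\<^sub>R exp (- cnj ?c * of_real x)
      + indicator {0<..} (0 + -1 * x) *\<^sub>R exp (- ?c * of_real (0 + -1 * x)))
      (1 / cnj ?c + (1 / ?c) /\<^sub>R \<bar>-1\<bar>)"
    by (intro has_bochner_integral_add 1 2)
  then have "has_bochner_integral lborel (\<lambda>x. exp (\<i> * of_real (s * x) - of_real (a * \<bar>x\<bar>)))
      (1 / cnj ?c + (1 / ?c) /\<^sub>R \<bar>-1\<bar>)"
    by (rule has_bochner_integral_discrete_difference[where X="{0}", THEN iffD1, rotated 4])
      (auto simp: indicator_def algebra_simps abs_if)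
  moreover have "1 / cnj ?c + (1 / ?c) /\<^sub>R \<bar>-1\<bar> = of_real (2 * Re (1 / ?c))"
    using complex_add_cnj[of "1 / ?c"] by (simp add: add.commute)
  ultimately show ?thesis by (simp only:)
qed

section \<open>Principal values on the line\<close>

text \<open>With $a = 1/2$ and $b = 1$ this is $1/f_1$ in the logarithmic variable (\<open>inverse_f1_exp\<close>
  below). All profiles have the same pole $1/y$ at the origin, since the factor \<open>b\<close> compensates for the
  denominator.\<close>

definition pv_profile :: "real \<Rightarrow> real \<Rightarrow> real \<Rightarrow> real" where
  "pv_profile a b y = b * exp (- a * y) / (1 - exp (- b * y))"

definition pv_kernel :: "real \<Rightarrow> real \<Rightarrow> real \<Rightarrow> real \<Rightarrow> complex" where
  "pv_kernel a b s x = of_real (pv_profile a b \<bar>x\<bar> / 2) * cis (s * x)"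

text \<open>Weil's principal value in the variable $x = \log\nu$. The integrability of the truncated
  integrand is made part of the notion, so that principal values can be added and scaled.\<close>

definition line_pv :: "(real \<Rightarrow> complex) \<Rightarrow> complex \<Rightarrow> complex \<Rightarrow> bool" where
  "line_pv g c I \<longleftrightarrow>
     integrable lborel (\<lambda>x. g x - c * of_real (pv_profile (1/2) 1 \<bar>x\<bar>)) \<and>
     (\<forall>t>0. integrable lborel (\<lambda>x. of_real (1 - exp (- t * \<bar>x\<bar>)) * g x)) \<and>
     ((\<lambda>t. of_real (2 * ln (2 * pi)) * c +
           ((LINT x|lborel. of_real (1 - exp (- t * \<bar>x\<bar>)) * g x) - 2 * c * of_real (ln t))) \<longlongrightarrow> I) at_top"

lemma line_pv_zero: "line_pv (\<lambda>_. 0) 0 0"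
  by (simp add: line_pv_def)

lemma line_pv_add:
  assumes f: "line_pv f c I" and g: "line_pv g d J"
  shows "line_pv (\<lambda>x. f x + g x) (c + d) (I + J)"
  unfolding line_pv_def
proof (intro conjI allI impI)
  show "integrable lborel (\<lambda>x. f x + g x - (c + d) * of_real (pv_profile (1/2) 1 \<bar>x\<bar>))"
    using Bochner_Integration.integrable_add[of lborel
        "\<lambda>x. f x - c * of_real (pv_profile (1/2) 1 \<bar>x\<bar>)" "\<lambda>x. g x - d * of_real (pv_profile (1/2) 1 \<bar>x\<bar>)"] f g
    by (simp add: line_pv_def algebra_simps)
  have int: "integrable lborel (\<lambda>x. of_real (1 - exp (- t * \<bar>x\<bar>)) * f x)"
    "integrable lborel (\<lambda>x. of_real (1 - exp (- t * \<bar>x\<bar>)) * g x)" if "t > 0" for t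
    using that f g by (simp_all add: line_pv_def)
  then show "integrable lborel (\<lambda>x. of_real (1 - exp (- t * \<bar>x\<bar>)) * (f x + g x))" if "t > 0" for t
    using that by (simp add: distrib_left)
  let ?T = "\<lambda>h c t. of_real (2 * ln (2 * pi)) * c +
    ((LINT x|lborel. of_real (1 - exp (- t * \<bar>x\<bar>)) * h x) - 2 * c * complex_of_real (ln t))"
  have "((\<lambda>t. ?T f c t + ?T g d t) \<longlongrightarrow> I + J) at_top"
    using f g by (intro tendsto_add) (simp_all add: line_pv_def)
  moreover have "eventually (\<lambda>t. ?T f c t + ?T g d t = ?T (\<lambda>x. f x + g x) (c + d) t) at_top"
    using eventually_gt_at_top[of 0]
  proof eventually_elim
    case (elim t)
    then have "(LINT x|lborel. of_real (1 - exp (- t * \<bar>x\<bar>)) * (f x + g x))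
       = (LINT x|lborel. of_real (1 - exp (- t * \<bar>x\<bar>)) * f x) + (LINT x|lborel. of_real (1 - exp (- t * \<bar>x\<bar>)) * g x)"
      using int[of t] by (simp only: distrib_left Bochner_Integration.integral_add)
    then show ?case by (simp only:) (simp add: algebra_simps)
  qed
  ultimately show "((\<lambda>t. ?T (\<lambda>x. f x + g x) (c + d) t) \<longlongrightarrow> I + J) at_top"
    by (rule Lim_transform_eventually)
qed

lemma line_pv_scale:
  assumes f: "line_pv f c I"
  shows "line_pv (\<lambda>x. k * f x) (k * c) (k * I)"
  unfolding line_pv_def
proof (intro conjI allI impI)
  have "integrable lborel (\<lambda>x. k * (f x - c * of_real (pv_profile (1/2) 1 \<bar>x\<bar>)))"
    using f by (intro integrable_mult_right) (simp add: line_pv_def)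
  then show "integrable lborel (\<lambda>x. k * f x - k * c * of_real (pv_profile (1/2) 1 \<bar>x\<bar>))"
    by (simp add: algebra_simps)
  show "integrable lborel (\<lambda>x. of_real (1 - exp (- t * \<bar>x\<bar>)) * (k * f x))" if "t > 0" for t
    unfolding mult.left_commute[of _ k] using f that
    by (intro integrable_mult_right) (simp add: line_pv_def)
  have "((\<lambda>t. k * (of_real (2 * ln (2 * pi)) * c +
        ((LINT x|lborel. of_real (1 - exp (- t * \<bar>x\<bar>)) * f x) - 2 * c * of_real (ln t)))) \<longlongrightarrow> k * I) at_top"
    using f by (intro tendsto_mult_left) (simp add: line_pv_def)
  then show "((\<lambda>t. of_real (2 * ln (2 * pi)) * (k * c) +
        ((LINT x|lborel. of_real (1 - exp (- t * \<bar>x\<bar>)) * (k * f x)) - 2 * (k * c) * of_real (ln t))) \<longlongrightarrow> k * I) at_top"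
    unfolding mult.left_commute[of _ k] integral_mult_right_zero by (simp add: algebra_simps)
qed

lemma line_pv_sum:
  assumes "finite A" "\<And>i. i \<in> A \<Longrightarrow> line_pv (f i) (c i) (I i)"
  shows "line_pv (\<lambda>x. \<Sum>i\<in>A. f i x) (\<Sum>i\<in>A. c i) (\<Sum>i\<in>A. I i)"
  using assms
  by (induction A rule: finite_induct) (simp_all add: line_pv_zero line_pv_add)

text \<open>Both bounds come from $1+u \le e^u$, applied to $u = -by$ and to $u = by$.\<close>

lemma pv_profile_bounds:
  assumes b: "b > 0" and y: "y > 0"
  shows "exp (- a * y) / y \<le> pv_profile a b y" "pv_profile a b y \<le> exp (- a * y) / y + b * exp (- a * y)"
proof -
  have q: "0 < 1 - exp (- b * y)" "1 - exp (- b * y) \<le> b * y"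
    using b y exp_ge_add_one_self[of "- b * y"] by auto
  have "1 / y \<le> b / (1 - exp (- b * y))"
    using q y b by (simp add: field_simps)
  then have "exp (- a * y) * (1 / y) \<le> exp (- a * y) * (b / (1 - exp (- b * y)))"
    by (intro mult_left_mono) auto
  then show "exp (- a * y) / y \<le> pv_profile a b y"
    by (simp add: pv_profile_def mult.commute)
  have "(1 + b * y) * exp (- b * y) \<le> exp (b * y) * exp (- b * y)"
    by (intro mult_right_mono exp_ge_add_one_self) auto
  then have "(1 + b * y) * exp (- b * y) \<le> 1" by (simp add: exp_add[symmetric])
  then have "b / (1 - exp (- b * y)) \<le> 1 / y + b"
    using q y by (simp add: field_simps)
  then have "exp (- a * y) * (b / (1 - exp (- b * y))) \<le> exp (- a * y) * (1 / y + b)"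
    by (intro mult_left_mono) auto
  then show "pv_profile a b y \<le> exp (- a * y) / y + b * exp (- a * y)"
    by (simp add: pv_profile_def algebra_simps)
qed

lemma pv_profile_nonneg: "b > 0 \<Longrightarrow> y \<ge> 0 \<Longrightarrow> 0 \<le> pv_profile a b y"
  by (simp add: pv_profile_def)

lemma integrable_exp_abs:
  assumes "a > 0"
  shows "integrable lborel (\<lambda>x. exp (- a * \<bar>x\<bar>) :: real)"
proof -
  have "integrable lborel (\<lambda>x. exp (\<i> * of_real (0 * x) - of_real (a * \<bar>x\<bar>)))"
    using laplace_line[OF assms, of 0] by (rule integrable.intros)
  then have "integrable lborel (\<lambda>x. cmod (exp (\<i> * of_real (0 * x) - of_real (a * \<bar>x\<bar>))))"
    by (rule Bochner_Integration.integrable_norm)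
  then show ?thesis by simp
qed

lemma norm_cis_minus_1_le: "cmod (cis t - 1) \<le> \<bar>t\<bar>"
  using abs_sin_x_le_abs_x[of "t / 2"] by (simp add: cis_conv_exp dist_exp_i_1)

lemma exp_diff_le:
  fixes p q y :: real
  assumes "0 \<le> y" 
  shows "\<bar>exp (- p * y) - exp (- q * y)\<bar> \<le> \<bar>p - q\<bar> * y * exp (- min p q * y)"
proof -
  have le: "exp (- p * y) - exp (- q * y) \<le> (q - p) * y * exp (- p * y)" "exp (- q * y) \<le> exp (- p * y)"
    if "p \<le> q" for p q
  proof -
    have "exp (- q * y) = exp (- p * y) * exp (- (q - p) * y)"
      by (simp add: exp_add[symmetric] algebra_simps)
    then have "exp (- p * y) - exp (- q * y) = (1 - exp (- (q - p) * y)) * exp (- p * y)"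
      by (simp add: algebra_simps)
    also have "\<dots> \<le> ((q - p) * y) * exp (- p * y)"
    proof (rule mult_right_mono)
      show "1 - exp (- (q - p) * y) \<le> (q - p) * y"
        using exp_ge_add_one_self[of "- (q - p) * y"] by linarith
    qed simp
    finally show "exp (- p * y) - exp (- q * y) \<le> (q - p) * y * exp (- p * y)" by simp
    show "exp (- q * y) \<le> exp (- p * y)" using that assms by (simp add: mult_right_mono)
  qed
  show ?thesis
    using le[of p q] le[of q p] by (cases "p \<le> q") (auto simp: min_def abs_if)
qed

lemma pv_kernel_measurable [measurable]: "pv_kernel a b s \<in> borel_measurable borel"
  unfolding pv_kernel_def pv_profile_def cis_conv_exp by measurable

text \<open>Near the origin the poles cancel. The difference splits into four parts, which compare the profile
  with $e^{-ay}/y$, the oscillating factor with $1$, the exponent $a$ with $1/2$, and $e^{-y/2}/y$ with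
  $1/f_1$. Each of them is $O(e^{-dy})$ with $d = \min(a, 1/2)$.\<close>

lemma integrable_kernel_minus_pole:
  assumes a: "a > 0" and b: "b > 0"
  shows "integrable lborel (\<lambda>x. pv_kernel a b s x - 1/2 * of_real (pv_profile (1/2) 1 \<bar>x\<bar>))"
proof -
  define d where "d = min a (1/2)"
  define C where "C = b + \<bar>s\<bar> + \<bar>a - 1/2\<bar> + 1"
  show ?thesis
  proof (rule Bochner_Integration.integrable_bound)
    show "integrable lborel (\<lambda>x. C * exp (- d * \<bar>x\<bar>) :: real)"
      using a by (intro integrable_mult_right integrable_exp_abs) (simp add: d_def)
    have [measurable]: "pv_profile (1/2) 1 \<in> borel_measurable borel"
      unfolding pv_profile_def by measurable
    show "(\<lambda>x. pv_kernel a b s x - 1/2 * of_real (pv_profile (1/2) 1 \<bar>x\<bar>)) \<in> borel_measurable lborel"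
      by measurable
    show "AE x in lborel. cmod (pv_kernel a b s x - 1/2 * of_real (pv_profile (1/2) 1 \<bar>x\<bar>))
        \<le> norm (C * exp (- d * \<bar>x\<bar>))"
      using AE_lborel_singleton[of 0]
    proof eventually_elim
      case (elim x)
      define y where "y = \<bar>x\<bar>"
      have y: "y > 0" using elim by (simp add: y_def)
      define E where "E = exp (- d * y)"
      have E: "exp (- a * y) \<le> E" "exp (- (1/2) * y) \<le> E"
        using y by (simp_all add: E_def d_def mult_right_mono)
      define u where "u = pv_profile a b y - exp (- a * y) / y"
      define v where "v = exp (- (1/2) * y) / y - pv_profile (1/2) 1 y"
      have u: "\<bar>u\<bar> \<le> b * E"
      proof -
        have "\<bar>u\<bar> \<le> b * exp (- a * y)"
          using pv_profile_bounds[OF b y, of a] by (simp add: u_def)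
        also have "\<dots> \<le> b * E" using E b by simp
        finally show ?thesis .
      qed
      have v: "\<bar>v\<bar> \<le> E"
        using pv_profile_bounds[OF _ y, of 1 "1/2"] E by (simp add: v_def abs_le_iff)
      have w: "cmod (of_real (exp (- a * y) / y) * (cis (s * x) - 1)) \<le> \<bar>s\<bar> * E"
      proof -
        have "cmod (of_real (exp (- a * y) / y) * (cis (s * x) - 1)) \<le> exp (- a * y) / y * \<bar>s * x\<bar>"
          unfolding norm_mult norm_of_real using y by (intro mult_mono norm_cis_minus_1_le) auto
        also have "\<dots> = \<bar>s\<bar> * exp (- a * y)" using y by (simp add: abs_mult y_def)
        also have "\<dots> \<le> \<bar>s\<bar> * E" using E by (intro mult_left_mono) auto
        finally show ?thesis .
      qed
      define k where "k = (exp (- a * y) - exp (- (1/2) * y)) / y"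
      have k: "\<bar>k\<bar> \<le> \<bar>a - 1/2\<bar> * E"
        using exp_diff_le[of y a "1/2"] y by (simp add: k_def E_def d_def field_simps)
      have "pv_kernel a b s x - 1/2 * of_real (pv_profile (1/2) 1 \<bar>x\<bar>)
         = (of_real u * cis (s * x) + of_real (exp (- a * y) / y) * (cis (s * x) - 1) + of_real k + of_real v) / 2"
        unfolding pv_kernel_def y_def[symmetric] u_def v_def k_def
        by (simp add: algebra_simps diff_divide_distrib)
      also have "cmod \<dots> \<le> (\<bar>u\<bar> + cmod (of_real (exp (- a * y) / y) * (cis (s * x) - 1)) + \<bar>k\<bar> + \<bar>v\<bar>) / 2"
      proof -
        have "cmod (of_real u * cis (s * x) + of_real (exp (- a * y) / y) * (cis (s * x) - 1) + of_real k + of_real v)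
          \<le> \<bar>u\<bar> + cmod (of_real (exp (- a * y) / y) * (cis (s * x) - 1)) + \<bar>k\<bar> + \<bar>v\<bar>"
          by (intro norm_triangle_le add_mono order_refl) (simp_all add: norm_mult)
        then show ?thesis unfolding norm_divide norm_numeral by (intro divide_right_mono) auto
      qed
      also have "\<dots> \<le> (b * E + \<bar>s\<bar> * E + \<bar>a - 1/2\<bar> * E + E) / 2"
        by (intro divide_right_mono add_mono u v w k) auto
      also have "\<dots> = C * E / 2" by (simp add: C_def algebra_simps)
      also have "\<dots> \<le> norm (C * E)" using b by (simp add: C_def E_def)
      finally show ?case by (simp add: E_def y_def)
    qed
  qed
qed

lemma norm_pv_kernel: "b > 0 \<Longrightarrow> cmod (pv_kernel a b s x) = pv_profile a b \<bar>x\<bar> / 2"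
  using pv_profile_nonneg[of b "\<bar>x\<bar>" a] by (simp add: pv_kernel_def norm_mult del: of_real_divide)

lemma integrable_cutoff_kernel:
  assumes a: "a > 0" and b: "b > 0" and t: "t > 0"
  shows "integrable lborel (\<lambda>x. of_real (1 - exp (- t * \<bar>x\<bar>)) * pv_kernel a b s x)"
proof (rule Bochner_Integration.integrable_bound)
  show "integrable lborel (\<lambda>x. (t + b) * exp (- a * \<bar>x\<bar>) :: real)"
    using a by (intro integrable_mult_right integrable_exp_abs)
  show "AE x in lborel. cmod (of_real (1 - exp (- t * \<bar>x\<bar>)) * pv_kernel a b s x)
      \<le> norm ((t + b) * exp (- a * \<bar>x\<bar>))"
    using AE_lborel_singleton[of 0]
  proof eventually_elim
    case (elim x)
    define y where "y = \<bar>x\<bar>"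
    have y: "y > 0" using elim by (simp add: y_def)
    have q: "0 \<le> 1 - exp (- t * y)" "1 - exp (- t * y) \<le> t * y" "1 - exp (- t * y) \<le> 1"
      using t y exp_ge_add_one_self[of "- t * y"] by auto
    have "cmod (of_real (1 - exp (- t * \<bar>x\<bar>)) * pv_kernel a b s x) = (1 - exp (- t * y)) * (pv_profile a b y / 2)"
      unfolding norm_mult norm_pv_kernel[OF b] norm_of_real using q by (simp add: y_def)
    also have "\<dots> \<le> (1 - exp (- t * y)) * (exp (- a * y) / y + b * exp (- a * y))"
    proof (rule mult_left_mono)
      show "pv_profile a b y / 2 \<le> exp (- a * y) / y + b * exp (- a * y)"
        using pv_profile_bounds(2)[OF b y, of a] pv_profile_nonneg[OF b, of y a] y by linarith
    qed (fact q)
    also have "\<dots> = (1 - exp (- t * y)) * (exp (- a * y) / y) + (1 - exp (- t * y)) * (b * exp (- a * y))"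
      by (rule distrib_left)
    also have "\<dots> \<le> (t * y) * (exp (- a * y) / y) + 1 * (b * exp (- a * y))"
      using q y b by (intro add_mono mult_right_mono) auto
    also have "\<dots> = (t + b) * exp (- a * y)" using y by (simp add: field_simps)
    finally show ?case using t b by (simp add: y_def)
  qed
qed measurable

text \<open>At multiples of \<open>b\<close> the cutoff factor cancels the denominator of the kernel and leaves the finite
  geometric sum $\sum_{n<N} e^{-bn|x|}$, whose terms have known integrals.\<close>

lemma integral_cutoff_multiple:
  assumes a: "a > 0" and b: "b > 0"
  shows "(LINT x|lborel. of_real (1 - exp (- (b * real N) * \<bar>x\<bar>)) * pv_kernel a b s x)
       = of_real (\<Sum>n<N. Re (inverse ((of_real a + \<i> * of_real s) / of_real b + of_nat n)))"
proof -
  have "has_bochner_integral lborel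
      (\<lambda>x. \<Sum>n<N. of_real (b / 2) * exp (\<i> * of_real (s * x) - of_real ((a + b * real n) * \<bar>x\<bar>)))
      (\<Sum>n<N. of_real (b / 2) * of_real (2 * Re (1 / (of_real (a + b * real n) + \<i> * of_real s))))"
    using a b by (intro has_bochner_integral_sum has_bochner_integral_mult_right laplace_line)
      (auto intro: add_pos_nonneg)
  then have "has_bochner_integral lborel (\<lambda>x. of_real (1 - exp (- (b * real N) * \<bar>x\<bar>)) * pv_kernel a b s x)
      (\<Sum>n<N. of_real (b / 2) * of_real (2 * Re (1 / (of_real (a + b * real n) + \<i> * of_real s))))"
  proof (rule has_bochner_integral_discrete_difference[where X="{0}", THEN iffD1, rotated 4])
    fix x :: real assume "x \<notin> {0}"
    define y where "y = \<bar>x\<bar>"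
    have y: "y > 0" using \<open>x \<notin> {0}\<close> by (simp add: y_def)
    define q where "q = exp (- b * y)"
    have q: "1 - q \<noteq> 0" using b y by (simp add: q_def)
    have qN: "exp (- (b * real n) * y) = q ^ n" for n
      by (simp add: q_def exp_of_nat_mult[symmetric] mult_ac)
    have "of_real (1 - exp (- (b * real N) * y)) * pv_kernel a b s x
        = of_real ((1 - q ^ N) * (b * exp (- a * y) / (1 - q) / 2)) * cis (s * x)"
      unfolding qN pv_kernel_def pv_profile_def y_def[symmetric] q_def[symmetric] by simp
    also have "(1 - q ^ N) * (b * exp (- a * y) / (1 - q) / 2) = (\<Sum>n<N. q ^ n) * (b / 2 * exp (- a * y))"
      using q by (simp add: one_diff_power_eq field_simps)
    also have "\<dots> = (\<Sum>n<N. b / 2 * exp (- (a + b * real n) * y))"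
      unfolding sum_distrib_right
      by (intro sum.cong refl) (simp add: qN[symmetric] exp_add[symmetric] algebra_simps)
    also have "of_real \<dots> * cis (s * x)
        = (\<Sum>n<N. of_real (b / 2) * exp (\<i> * of_real (s * x) - of_real ((a + b * real n) * y)))"
      unfolding of_real_sum sum_distrib_right
      by (intro sum.cong refl)
        (simp only: cis_conv_exp of_real_mult exp_of_real[symmetric] mult.assoc exp_add[symmetric],
          simp add: algebra_simps)
    finally show "(\<Sum>n<N. of_real (b / 2) * exp (\<i> * of_real (s * x) - of_real ((a + b * real n) * \<bar>x\<bar>)))
       = of_real (1 - exp (- (b * real N) * \<bar>x\<bar>)) * pv_kernel a b s x"
      by (simp add: y_def)
  qed auto
  then have "(LINT x|lborel. of_real (1 - exp (- (b * real N) * \<bar>x\<bar>)) * pv_kernel a b s x)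
      = (\<Sum>n<N. of_real (b / 2) * of_real (2 * Re (1 / (of_real (a + b * real n) + \<i> * of_real s))))"
    by (rule has_bochner_integral_integral_eq)
  also have "\<dots> = of_real (\<Sum>n<N. Re (inverse ((of_real a + \<i> * of_real s) / of_real b + of_nat n)))"
    unfolding of_real_sum
  proof (intro sum.cong refl)
    fix n
    have "inverse ((of_real a + \<i> * of_real s) / of_real b + of_nat n)
        = of_real b * (1 / (of_real (a + b * real n) + \<i> * of_real s))"
      using b by (simp add: field_simps)
    then have "Re (inverse ((of_real a + \<i> * of_real s) / of_real b + of_nat n))
        = b * Re (1 / (of_real (a + b * real n) + \<i> * of_real s))"
      by (simp only: Re_complex_of_real times_complex.sel Im_complex_of_real mult_zero_left diff_zero)
    then show "of_real (b / 2) * of_real (2 * Re (1 / (of_real (a + b * real n) + \<i> * of_real s)))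
        = complex_of_real (Re (inverse ((of_real a + \<i> * of_real s) / of_real b + of_nat n)))"
      by simp
  qed
  finally show ?thesis .
qed

text \<open>Between two consecutive multiples of \<open>b\<close> the cutoff factor changes by at most
  $e^{-bN|x|}(1-e^{-b|x|})$, and the second factor cancels the denominator of the kernel.\<close>

lemma cutoff_interpolation:
  assumes a: "a > 0" and b: "b > 0" and N: "N > 0" "b * real N \<le> t" "t \<le> b * real (Suc N)"
  shows "cmod ((LINT x|lborel. of_real (1 - exp (- t * \<bar>x\<bar>)) * pv_kernel a b s x)
             - (LINT x|lborel. of_real (1 - exp (- (b * real N) * \<bar>x\<bar>)) * pv_kernel a b s x))
         \<le> b / (a + b * real N)"
proof -
  let ?c = "a + b * real N"
  have bN: "b * real N > 0" using b N by simp
  have t: "t > 0" using bN N(2) by linarith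
  have c: "?c > 0" using a bN by linarith
  have "(LINT x|lborel. of_real (1 - exp (- t * \<bar>x\<bar>)) * pv_kernel a b s x)
             - (LINT x|lborel. of_real (1 - exp (- (b * real N) * \<bar>x\<bar>)) * pv_kernel a b s x)
      = (LINT x|lborel. of_real (1 - exp (- t * \<bar>x\<bar>)) * pv_kernel a b s x
             - of_real (1 - exp (- (b * real N) * \<bar>x\<bar>)) * pv_kernel a b s x)"
    by (intro Bochner_Integration.integral_diff[symmetric] integrable_cutoff_kernel a b t bN)
  also have "\<dots> = (LINT x|lborel. of_real (exp (- (b * real N) * \<bar>x\<bar>) - exp (- t * \<bar>x\<bar>)) * pv_kernel a b s x)"
    by (intro Bochner_Integration.integral_cong refl) (simp add: algebra_simps)
  also have "cmod \<dots> \<le> (LINT x|lborel. b / 2 * exp (- ?c * \<bar>x\<bar>))"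
  proof (rule Bochner_Integration.integral_norm_bound_integral)
    have "integrable lborel (\<lambda>x. of_real (1 - exp (- t * \<bar>x\<bar>)) * pv_kernel a b s x
             - of_real (1 - exp (- (b * real N) * \<bar>x\<bar>)) * pv_kernel a b s x)"
      by (intro Bochner_Integration.integrable_diff integrable_cutoff_kernel a b t bN)
    then show "integrable lborel (\<lambda>x. of_real (exp (- (b * real N) * \<bar>x\<bar>) - exp (- t * \<bar>x\<bar>)) * pv_kernel a b s x)"
      by (simp add: algebra_simps)
    show "integrable lborel (\<lambda>x. b / 2 * exp (- ?c * \<bar>x\<bar>))"
      by (intro integrable_mult_right integrable_exp_abs c)
    fix x :: real
    define y where "y = \<bar>x\<bar>"
    have y: "y \<ge> 0" by (simp add: y_def)
    show "cmod (of_real (exp (- (b * real N) * \<bar>x\<bar>) - exp (- t * \<bar>x\<bar>)) * pv_kernel a b s x) \<le> b / 2 * exp (- ?c * \<bar>x\<bar>)"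
    proof (cases "y = 0")
      case True
      then show ?thesis using b by (simp add: y_def)
    next
      case False
      then have y0: "y > 0" using y by simp
      have q: "0 < 1 - exp (- b * y)" using b y0 by simp
      have 1: "exp (- t * y) \<le> exp (- (b * real N) * y)"
        using N(2) y by (simp add: mult_right_mono)
      have "exp (- (b * real N) * y) * exp (- b * y) = exp (- (b * real (Suc N)) * y)"
        by (simp add: exp_add[symmetric] algebra_simps)
      also have "\<dots> \<le> exp (- t * y)" using N(3) y by (simp add: mult_right_mono)
      finally have 2: "exp (- (b * real N) * y) - exp (- t * y) \<le> exp (- (b * real N) * y) * (1 - exp (- b * y))"
        by (simp add: algebra_simps)
      have "cmod (of_real (exp (- (b * real N) * y) - exp (- t * y)) * pv_kernel a b s x)
          = (exp (- (b * real N) * y) - exp (- t * y)) * (pv_profile a b y / 2)"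
        unfolding norm_mult norm_pv_kernel[OF b] norm_of_real using 1 by (simp add: y_def)
      also have "\<dots> \<le> exp (- (b * real N) * y) * (1 - exp (- b * y)) * (pv_profile a b y / 2)"
        using pv_profile_nonneg[OF b y, of a] by (intro mult_right_mono 2) auto
      also have "\<dots> = b / 2 * (exp (- (b * real N) * y) * exp (- a * y))"
      proof -
        have "q * Q * (b * A / Q / 2) = b / 2 * (q * A)" if "Q \<noteq> 0" for q Q A :: real
          using that by simp
        from this[OF less_imp_neq[OF q, symmetric]] show ?thesis unfolding pv_profile_def .
      qed
      also have "\<dots> = b / 2 * exp (- ?c * y)"
        by (simp add: exp_add[symmetric] algebra_simps)
      finally show ?thesis by (simp add: y_def)
    qed
  qed
  also have "\<dots> = b / ?c"
  proof -
    have "has_bochner_integral lborel (\<lambda>x. Re (exp (\<i> * of_real (0 * x) - of_real (?c * \<bar>x\<bar>))))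
        (Re (of_real (2 * Re (1 / (of_real ?c + \<i> * of_real 0)))))"
      by (intro has_bochner_integral_bounded_linear[OF bounded_linear_Re] laplace_line c)
    moreover have "Re (exp (\<i> * of_real (0 * x) - of_real (?c * \<bar>x\<bar>))) = exp (- ?c * \<bar>x\<bar>)" for x
      by (simp add: Re_exp algebra_simps)
    moreover have "Re (of_real (2 * Re (1 / (of_real ?c + \<i> * of_real 0)))) = 2 / ?c"
      by (simp add: Re_divide power2_eq_square del: of_real_add)
    ultimately have "has_bochner_integral lborel (\<lambda>x. exp (- ?c * \<bar>x\<bar>)) (2 / ?c)"
      by (simp only:)
    then have "(LINT x|lborel. exp (- ?c * \<bar>x\<bar>)) = 2 / ?c"
      by (rule has_bochner_integral_integral_eq)
    then show ?thesis by (simp only: integral_mult_right_zero) simp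
  qed
  finally show ?thesis .
qed

text \<open>The value on multiples of \<open>b\<close> minus $\log N$ converges by Euler's limit for the digamma function,
  the interpolation error vanishes, and $\log\lfloor t/b\rfloor - \log t \to -\log b$ accounts for the
  term in \<open>b\<close>.\<close>

lemma line_pv_kernel:
  assumes a: "a > 0" and b: "b > 0"
  shows "line_pv (pv_kernel a b s) (1/2)
           (of_real (ln (2 * pi) - ln b - Re (Digamma ((of_real a + \<i> * of_real s) / of_real b))))"
proof -
  let ?z = "(of_real a + \<i> * of_real s) / complex_of_real b"
  define T where "T t = (LINT x|lborel. of_real (1 - exp (- t * \<bar>x\<bar>)) * pv_kernel a b s x)" for t
  define n where "n t = nat \<lfloor>t / b\<rfloor>" for t
  have n_lim: "filterlim n sequentially at_top"
  proof -
    have "filterlim (\<lambda>t. t / b) at_top at_top"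
      using b by real_asymp
    then show ?thesis unfolding n_def
      by (intro filterlim_compose[OF filterlim_nat_sequentially]
          filterlim_compose[OF filterlim_floor_sequentially])
  qed
  have n_bounds: "eventually (\<lambda>t. n t > 0 \<and> b * real (n t) \<le> t \<and> t \<le> b * real (Suc (n t))) at_top"
    using eventually_ge_at_top[of b]
  proof eventually_elim
    case (elim t)
    have "t / b \<ge> 1" using elim b by simp
    then have 1: "real (n t) = of_int \<lfloor>t / b\<rfloor>" "n t > 0" by (simp_all add: n_def)
    have "real (n t) \<le> t / b" "t / b \<le> real (n t) + 1"
      unfolding 1 by linarith+
    then show ?case using 1(2) b by (simp add: field_simps)
  qed
  have z0: "?z \<noteq> 0" using a b by (auto simp: complex_eq_iff)
  have "(\<lambda>N. of_real (ln (real N)) - (\<Sum>k<N. inverse (?z + of_nat k))) \<longlonglongrightarrow> Digamma ?z"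
    by (rule Digamma_LIMSEQ[OF z0])
  then have "(\<lambda>N. Re (of_real (ln (real N)) - (\<Sum>k<N. inverse (?z + of_nat k)))) \<longlonglongrightarrow> Re (Digamma ?z)"
    by (rule tendsto_Re)
  then have "(\<lambda>N. of_real (- Re (of_real (ln (real N)) - (\<Sum>k<N. inverse (?z + of_nat k))))) \<longlonglongrightarrow> complex_of_real (- Re (Digamma ?z))"
    by (intro tendsto_of_real tendsto_minus)
  also have "(\<lambda>N. of_real (- Re (of_real (ln (real N)) - (\<Sum>k<N. inverse (?z + of_nat k)))))
      = (\<lambda>N. T (b * real N) - of_real (ln (real N)))"
    unfolding T_def integral_cutoff_multiple[OF a b] by (simp add: fun_eq_iff)
  finally have "((\<lambda>t. T (b * real (n t)) - of_real (ln (real (n t)))) \<longlongrightarrow> complex_of_real (- Re (Digamma ?z))) at_top"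
    by (rule filterlim_compose[OF _ n_lim])
  moreover have "((\<lambda>t. T t - T (b * real (n t))) \<longlongrightarrow> 0) at_top"
  proof (rule Lim_null_comparison)
    show "eventually (\<lambda>t. cmod (T t - T (b * real (n t))) \<le> b / (a + b * real (n t))) at_top"
      using n_bounds
      by eventually_elim (use cutoff_interpolation[OF a b] in \<open>simp add: T_def\<close>)
    have "(\<lambda>N. b / (a + b * real N)) \<longlonglongrightarrow> 0" using a b by real_asymp
    then show "((\<lambda>t. b / (a + b * real (n t))) \<longlongrightarrow> 0) at_top"
      by (rule filterlim_compose[OF _ n_lim])
  qed
  moreover have "((\<lambda>t. complex_of_real (ln (real (n t)) - ln t)) \<longlongrightarrow> of_real (- ln b)) at_top"
  proof (intro tendsto_of_real)
    have "((\<lambda>t. ln (real_of_int \<lfloor>t / b\<rfloor>) - ln t) \<longlongrightarrow> - ln b) at_top"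
      using b by (real_asymp simp: ln_inverse)
    moreover have "eventually (\<lambda>t. ln (real_of_int \<lfloor>t / b\<rfloor>) - ln t = ln (real (n t)) - ln t) at_top"
      using eventually_ge_at_top[of 0] by eventually_elim (use b in \<open>simp add: n_def\<close>)
    ultimately show "((\<lambda>t. ln (real (n t)) - ln t) \<longlongrightarrow> - ln b) at_top"
      by (rule Lim_transform_eventually)
  qed
  ultimately have "((\<lambda>t. (T (b * real (n t)) - of_real (ln (real (n t)))) + (T t - T (b * real (n t)))
      + complex_of_real (ln (real (n t)) - ln t)) \<longlongrightarrow>
      complex_of_real (- Re (Digamma ?z)) + 0 + of_real (- ln b)) at_top"
    by (intro tendsto_add)
  then have "((\<lambda>t. of_real (2 * ln (2 * pi)) * (1/2) + (T t - 2 * (1/2) * of_real (ln t)))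
      \<longlongrightarrow> of_real (ln (2 * pi)) + (complex_of_real (- Re (Digamma ?z)) + 0 + of_real (- ln b))) at_top"
    by (intro tendsto_add) simp_all
  then show ?thesis
    unfolding line_pv_def T_def
    using integrable_kernel_minus_pole[OF a b] integrable_cutoff_kernel[OF a b]
    by (simp add: algebra_simps)
qed

lemma f0_exp: "f0 (exp x) = exp (- \<bar>x\<bar> / 2)"
  by (simp add: f0_def powr_def min_def abs_if)

lemma inverse_f1_exp: "inverse (f1 (exp x)) = pv_profile (1/2) 1 \<bar>x\<bar>"
proof -
  have "exp (- \<bar>x\<bar> / 2) * exp (- \<bar>x\<bar> / 2) = exp (- \<bar>x\<bar>)" by (simp add: exp_add[symmetric])
  then have "f1 (exp x) * exp (- \<bar>x\<bar> / 2) = 1 - exp (- \<bar>x\<bar>)"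
    unfolding f1_def f0_exp by (simp add: left_diff_distrib)
  then have "f1 (exp x) = (1 - exp (- \<bar>x\<bar>)) / exp (- \<bar>x\<bar> / 2)"
    by (simp add: eq_divide_eq)
  then show ?thesis by (simp add: pv_profile_def)
qed

text \<open>The fibre over $\nu = 1$ is exempt because the integrands of interest have their pole $u = 1$ on it;
  it corresponds to $x = 0$, a null set.\<close>

lemma has_weil_pvI:
  assumes fib: "\<And>\<nu>. \<nu> > 0 \<Longrightarrow> \<nu> \<noteq> 1 \<Longrightarrow> fibre_integrable \<phi> \<nu>"
    and meas [measurable]: "fibre_integral \<phi> \<in> borel_measurable borel"
    and eq: "\<And>x. x \<noteq> 0 \<Longrightarrow> fibre_integral \<phi> (exp x) = g x"
    and g: "line_pv g c I"
  shows "has_weil_pv \<phi> I"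
  unfolding has_weil_pv_def
proof (intro conjI exI[of _ c])
  show "AE \<nu> in mult_haar. fibre_integrable \<phi> \<nu>"
  proof -
    have "AE \<nu> in lborel. 0 < ennreal (indicator {0<..} \<nu> / \<nu>) \<longrightarrow> fibre_integrable \<phi> \<nu>"
      using AE_lborel_singleton[of 1]
      by eventually_elim (use fib in \<open>auto simp: indicator_def split: if_splits\<close>)
    then show ?thesis unfolding mult_haar_def by (subst AE_density) auto
  qed
  have [measurable]: "f0 \<in> borel_measurable borel" unfolding f0_def by measurable
  have [measurable]: "f1 \<in> borel_measurable borel" unfolding f1_def by measurable
  have "integrable lborel (\<lambda>x. g x - c * of_real (pv_profile (1/2) 1 \<bar>x\<bar>))"
    using g by (simp add: line_pv_def)
  then have "integrable lborel (\<lambda>x. fibre_integral \<phi> (exp x) - c * of_real (inverse (f1 (exp x))))"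
    by (subst integrable_discrete_difference[where X = "{0}"]) (auto simp: eq inverse_f1_exp)
  then show "integrable mult_haar (\<lambda>\<nu>. fibre_integral \<phi> \<nu> - c * of_real (inverse (f1 \<nu>)))"
    unfolding mult_haar_eq_distr_exp
    by (subst integrable_distr_eq) (auto intro!: borel_measurable_diff borel_measurable_times)
  have "(LINT \<nu>|mult_haar. of_real (1 - f0 \<nu> powr (2 * t)) * fibre_integral \<phi> \<nu>)
      = (LINT x|lborel. of_real (1 - exp (- t * \<bar>x\<bar>)) * g x)" for t
  proof -
    have "(LINT \<nu>|mult_haar. of_real (1 - f0 \<nu> powr (2 * t)) * fibre_integral \<phi> \<nu>)
        = (LINT x|lborel. of_real (1 - f0 (exp x) powr (2 * t)) * fibre_integral \<phi> (exp x))"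
      unfolding mult_haar_eq_distr_exp by (subst integral_distr) auto
    also have "\<dots> = (LINT x|lborel. of_real (1 - exp (- t * \<bar>x\<bar>)) * g x)"
      by (rule integral_discrete_difference[where X = "{0}"]) (auto simp: eq f0_exp powr_def)
    finally show ?thesis .
  qed
  then show "((\<lambda>t. of_real (2 * ln (2 * pi)) * c +
                ((LINT \<nu>|mult_haar. of_real (1 - f0 \<nu> powr (2 * t)) * fibre_integral \<phi> \<nu>)
                 - 2 * c * of_real (ln t))) \<longlongrightarrow> I) at_top"
    using g by (simp add: line_pv_def)
qed

section \<open>Logarithms of the local factor\<close>

lemma Im_along_line_has_derivative:
  assumes "(f has_field_derivative D) (at (of_real c + \<i> * of_real s))"
  shows "((\<lambda>s. Im (f (of_real c + \<i> * of_real s))) has_real_derivative Re D) (at s)"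
proof -
  have "((\<lambda>s. of_real c + \<i> * of_real s) has_vector_derivative \<i>) (at s)"
    by (auto intro!: derivative_eq_intros)
  then have "((f \<circ> (\<lambda>s. of_real c + \<i> * of_real s)) has_vector_derivative \<i> * D) (at s)"
    by (rule field_vector_diff_chain_at) (rule assms)
  then have "((\<lambda>s. Im ((f \<circ> (\<lambda>s. of_real c + \<i> * of_real s)) s)) has_vector_derivative Im (\<i> * D)) (at s)"
    by (rule bounded_linear.has_vector_derivative[OF bounded_linear_Im])
  then show ?thesis by (simp add: o_def has_real_derivative_iff_has_vector_derivative)
qed

definition log_Gamma_C :: "complex \<Rightarrow> complex" where
  "log_Gamma_C z = ln_Gamma z - z * of_real (ln (2 * pi))"

definition log_Gamma_R :: "complex \<Rightarrow> complex" where
  "log_Gamma_R z = ln_Gamma (z / 2) - z / 2 * of_real (ln pi) - of_real (ln 2 / 2)"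

lemma right_half_plane_nonpos:
  assumes "Re z > 0" shows "z \<notin> \<real>\<^sub>\<le>\<^sub>0" "z \<notin> \<int>\<^sub>\<le>\<^sub>0"
  using assms nonpos_Ints_subset_nonpos_Reals by (auto simp: complex_nonpos_Reals_iff)

lemma (in real_hodge) exp_log_Gamma_C: "Re z > 0 \<Longrightarrow> exp (log_Gamma_C z) = Gamma_C z"
  by (simp add: log_Gamma_C_def Gamma_C_def right_half_plane_nonpos Gamma_complex_altdef
      powr_def exp_diff exp_minus Ln_of_real field_simps del: of_real_mult)

lemma (in real_hodge) exp_log_Gamma_R: "Re z > 0 \<Longrightarrow> exp (log_Gamma_R z) = Gamma_R z"
proof -
  assume z: "Re z > 0"
  then have "Gamma (z / 2) = exp (ln_Gamma (z / 2))"
    by (simp add: Gamma_complex_altdef right_half_plane_nonpos)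
  moreover have "complex_of_real (2 powr (- (1 / 2))) = exp (- of_real (ln 2 / 2))"
    by (simp add: powr_def flip: exp_of_real)
  moreover have "complex_of_real pi powr (- z / 2) = exp (- (z / 2 * of_real (ln pi)))"
    by (simp add: powr_def Ln_of_real)
  ultimately show ?thesis unfolding Gamma_R_def log_Gamma_R_def
    by (simp only: exp_add[symmetric]) (simp add: algebra_simps)
qed

lemma log_Gamma_C_derivative:
  assumes "Re z > 0"
  shows "(log_Gamma_C has_field_derivative (Digamma z - of_real (ln (2 * pi)))) (at z)"
  unfolding log_Gamma_C_def[abs_def]
  using right_half_plane_nonpos[OF assms] by (auto intro!: derivative_eq_intros simp del: of_real_mult)

lemma log_Gamma_R_derivative:
  assumes "Re z > 0"
  shows "(log_Gamma_R has_field_derivative ((Digamma (z / 2) - of_real (ln pi)) / 2)) (at z)"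
  unfolding log_Gamma_R_def[abs_def]
  using right_half_plane_nonpos[of "z / 2"] assms
  by (auto intro!: derivative_eq_intros simp: diff_divide_distrib)

text \<open>The difference is continuous with values in $2\pi i\mathbb{Z}$, hence constant on a connected line.\<close>

lemma log_branches_differ_by_constant:
  assumes l: "log_branch_on_line f \<sigma> l" and l0: "log_branch_on_line f \<sigma> l0"
  obtains k where "\<And>s. l s = l0 s + k"
proof -
  have "(\<lambda>s. l s - l0 s) constant_on UNIV"
  proof (rule continuous_discrete_range_constant)
    show "continuous_on UNIV (\<lambda>s. l s - l0 s)"
      using l l0 by (auto simp: log_branch_on_line_def intro!: continuous_intros)
    have "exp (l s) = exp (l0 s)" for s
      using l l0 by (simp add: log_branch_on_line_def)
    then have e: "exp (l s - l0 s) = 1" for s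
      by (simp add: exp_diff)
    have "2 * pi \<le> cmod ((l y - l0 y) - (l x - l0 x))" if "l y - l0 y \<noteq> l x - l0 x" for x y
    proof -
      obtain a b :: int where ab: "Re (l x - l0 x) = 0" "Im (l x - l0 x) = of_int (2 * a) * pi"
        "Re (l y - l0 y) = 0" "Im (l y - l0 y) = of_int (2 * b) * pi"
        using e[of x] e[of y] unfolding exp_eq_1 by blast
      then have "a \<noteq> b" using that by (auto simp: complex_eq_iff)
      then have "1 \<le> \<bar>b - a\<bar>" by linarith
      then have "1 \<le> \<bar>real_of_int (b - a)\<bar>" by linarith
      then have "2 * pi * 1 \<le> 2 * pi * \<bar>real_of_int (b - a)\<bar>" by (intro mult_left_mono) auto
      also have "\<dots> = \<bar>Im ((l y - l0 y) - (l x - l0 x))\<bar>"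
      proof -
        have "Im ((l y - l0 y) - (l x - l0 x)) = of_int (2 * b) * pi - of_int (2 * a) * pi"
          by (simp only: minus_complex.sel(2)[of "l y - l0 y"] ab)
        also have "\<dots> = 2 * pi * real_of_int (b - a)" by (simp add: algebra_simps)
        finally show ?thesis by (simp add: abs_mult)
      qed
      also have "\<dots> \<le> cmod ((l y - l0 y) - (l x - l0 x))" by (rule abs_Im_le_cmod)
      finally show ?thesis by simp
    qed
    then show "\<exists>e>0. \<forall>y. y \<in> UNIV \<and> l y - l0 y \<noteq> l x - l0 x \<longrightarrow> e \<le> cmod (l y - l0 y - (l x - l0 x))" for x
      by (intro exI[of _ "2 * pi"]) auto
  qed simp
  then obtain k where "\<And>s. l s - l0 s = k" by (auto simp: constant_on_def)
  then have "\<And>s. l s = l0 s + k" by (metis diff_add_cancel add.commute)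
  then show thesis by (rule that)
qed

context real_hodge
begin

definition log_L_R :: "complex \<Rightarrow> complex" where
  "log_L_R z =
     (\<Sum>(p, q)\<in>{(p, q). p < q \<and> p + q = m}. of_nat (hodge_number p q) * log_Gamma_C (z - of_nat p)) +
     (\<Sum>p\<in>{p. 2 * p = m}. of_nat (hodge_plus p) * log_Gamma_R (z - of_nat p)
                         + of_nat (hodge_minus p) * log_Gamma_R (z - of_nat p + 1))"

lemma finite_index: "finite {(p, q). p < q \<and> p + q = m}" "finite {p. 2 * p = m}"
proof -
  show "finite {(p, q). p < q \<and> p + q = m}"
    by (rule finite_subset[OF _ finite_bidegrees]) blast
  show "finite {p. 2 * p = m}"
    by (rule finite_subset[of _ "{..m}"]) auto
qed

lemma exp_log_L_R:
  assumes "Re z = (1 + real m) / 2"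
  shows "exp (log_L_R z) = L_R z"
proof -
  have "exp (log_L_R z) =
     (\<Prod>i\<in>{(p, q). p < q \<and> p + q = m}.
        exp (case i of (p, q) \<Rightarrow> of_nat (hodge_number p q) * log_Gamma_C (z - of_nat p))) *
     (\<Prod>p\<in>{p. 2 * p = m}. exp (of_nat (hodge_plus p) * log_Gamma_R (z - of_nat p)
                         + of_nat (hodge_minus p) * log_Gamma_R (z - of_nat p + 1)))"
    unfolding log_L_R_def exp_add[of "sum _ _"] exp_sum[OF finite_index(1)] exp_sum[OF finite_index(2)] ..
  also have "\<dots> = L_R z" unfolding L_R_def
  proof (intro arg_cong2[where f = "(*)"] prod.cong refl, goal_cases)
    case (1 i)
    obtain p q where i: "i = (p, q)" by (cases i)
    with 1 have "p < q" "real m = real p + real q" by auto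
    then have "Re (z - of_nat p) > 0" using assms by simp
    then show ?case by (simp add: i exp_of_nat_mult exp_log_Gamma_C)
  next
    case (2 p)
    then have "real m = 2 * real p" by auto
    then have "Re (z - of_nat p) > 0" "Re (z - of_nat p + 1) > 0" using assms by simp_all
    then show ?case by (simp add: exp_add exp_of_nat_mult exp_log_Gamma_R)
  qed
  finally show ?thesis .
qed

text \<open>The derivative in \<open>s\<close> of the imaginary part of \<open>log_L_R\<close> along the critical line, where
  $z - p$ equals $(q-p+1)/2 + is$ if $p + q = m$, and in particular $1/2 + is$ if $2p = m$.\<close>

definition log_L_R_slope :: "real \<Rightarrow> real" where
  "log_L_R_slope s =
     (\<Sum>(p, q)\<in>{(p, q). p < q \<and> p + q = m}. real (hodge_number p q) *
        (Re (Digamma (of_real (real (q - p + 1) / 2) + \<i> * of_real s)) - ln (2 * pi))) +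
     (\<Sum>p\<in>{p. 2 * p = m}.
        real (hodge_plus p) * ((Re (Digamma ((of_real (1 / 2) + \<i> * of_real s) / 2)) - ln pi) / 2) +
        real (hodge_minus p) * ((Re (Digamma ((of_real (3 / 2) + \<i> * of_real s) / 2)) - ln pi) / 2))"

lemma log_L_R_derivative:
  defines "\<sigma> \<equiv> (1 + real m) / 2"
  obtains D where "(log_L_R has_field_derivative D) (at (of_real \<sigma> + \<i> * of_real s))"
    and "Re D = log_L_R_slope s"
proof -
  let ?z = "of_real \<sigma> + \<i> * of_real s"
  define D where "D = (\<Sum>(p, q)\<in>{(p, q). p < q \<and> p + q = m}. of_nat (hodge_number p q) *
        (Digamma (?z - of_nat p) - of_real (ln (2 * pi)))) +
     (\<Sum>p\<in>{p. 2 * p = m}.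
        of_nat (hodge_plus p) * ((Digamma ((?z - of_nat p) / 2) - of_real (ln pi)) / 2) +
        of_nat (hodge_minus p) * ((Digamma ((?z - of_nat p + 1) / 2) - of_real (ln pi)) / 2))"
  have C: "(log_Gamma_C has_field_derivative Digamma (?z - of_nat p) - of_real (ln (2 * pi))) (at (?z - of_nat p))"
    "?z - of_nat p = of_real (real (q - p + 1) / 2) + \<i> * of_real s"
    if "p < q" "p + q = m" for p q
  proof -
    have "real m = real p + real q" "real (q - p + 1) = real q - real p + 1" using that by auto
    then show eq: "?z - of_nat p = of_real (real (q - p + 1) / 2) + \<i> * of_real s"
      by (simp only: \<sigma>_def complex_eq_iff) (simp add: field_simps)
    show "(log_Gamma_C has_field_derivative Digamma (?z - of_nat p) - of_real (ln (2 * pi))) (at (?z - of_nat p))"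
      by (rule log_Gamma_C_derivative) (simp add: eq)
  qed
  have R: "(log_Gamma_R has_field_derivative (Digamma ((?z - of_nat p) / 2) - of_real (ln pi)) / 2) (at (?z - of_nat p))"
    "(log_Gamma_R has_field_derivative (Digamma ((?z - of_nat p + 1) / 2) - of_real (ln pi)) / 2) (at (?z - of_nat p + 1))"
    "?z - of_nat p = of_real (1 / 2) + \<i> * of_real s" "?z - of_nat p + 1 = of_real (3 / 2) + \<i> * of_real s"
    if "2 * p = m" for p
  proof -
    have "real m = 2 * real p" using that by auto
    then show eq: "?z - of_nat p = of_real (1 / 2) + \<i> * of_real s" 
      "?z - of_nat p + 1 = of_real (3 / 2) + \<i> * of_real s"
      by (simp_all only: \<sigma>_def complex_eq_iff) (simp_all add: field_simps)
    show "(log_Gamma_R has_field_derivative (Digamma ((?z - of_nat p) / 2) - of_real (ln pi)) / 2) (at (?z - of_nat p))"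
      "(log_Gamma_R has_field_derivative (Digamma ((?z - of_nat p + 1) / 2) - of_real (ln pi)) / 2) (at (?z - of_nat p + 1))"
      by (rule log_Gamma_R_derivative, simp add: eq)+
  qed
  have shift: "((\<lambda>z. f (z - c + d)) has_field_derivative D) (at z)"
    if "(f has_field_derivative D) (at (z - c + d))" for f D and c d z :: complex
  proof -
    have "((\<lambda>z. z - c + d) has_field_derivative 1) (at z)" by (auto intro!: derivative_eq_intros)
    from DERIV_chain2[where g = "\<lambda>z. z - c + d", OF that this] show ?thesis by simp
  qed
  have "(log_L_R has_field_derivative D) (at ?z)"
    unfolding log_L_R_def[abs_def] D_def case_prod_unfold
  proof (intro DERIV_add DERIV_sum DERIV_cmult, goal_cases)
    case (1 i)
    then have "fst i < snd i" "fst i + snd i = m" by auto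
    from shift[where d = 0, unfolded add_0_right, OF C(1)[OF this]] show ?case .
  next
    case (2 p)
    then have "2 * p = m" by simp
    from shift[where d = 0, unfolded add_0_right, OF R(1)[OF this]] show ?case .
  next
    case (3 p)
    then have "2 * p = m" by simp
    from shift[OF R(2)[OF this]] show ?case .
  qed
  moreover have "Re D = log_L_R_slope s"
    unfolding D_def log_L_R_slope_def plus_complex.sel Re_sum
  proof (intro arg_cong2[where f = "(+)"] sum.cong refl, goal_cases)
    case (1 i)
    obtain p q where i: "i = (p, q)" by (cases i)
    with 1 have "p < q" "p + q = m" by auto
    show ?case unfolding i prod.case C(2)[OF \<open>p < q\<close> \<open>p + q = m\<close>]
      by (simp del: of_real_add of_real_divide of_real_mult)
  next
    case (2 p)
    then have "2 * p = m" by simp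
    show ?case unfolding R(3)[OF \<open>2 * p = m\<close>]
      by (simp del: of_real_divide)
  next
    case (3 p)
    then have "2 * p = m" by simp
    show ?case unfolding R(4)[OF \<open>2 * p = m\<close>]
      by (simp del: of_real_divide)
  qed
  ultimately show thesis by (rule that)
qed

lemma log_branch_log_L_R:
  "log_branch_on_line L_R ((1 + real m) / 2) (\<lambda>s. log_L_R (of_real ((1 + real m) / 2) + \<i> * of_real s))"
  unfolding log_branch_on_line_def
proof (intro conjI allI continuous_at_imp_continuous_on ballI)
  fix s :: real
  obtain D where D: "(log_L_R has_field_derivative D) (at (of_real ((1 + real m) / 2) + \<i> * of_real s))"
    using log_L_R_derivative by blast
  have "isCont (\<lambda>s. of_real ((1 + real m) / 2) + \<i> * of_real s) s"
    by (intro continuous_intros)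
  then show "isCont (\<lambda>s. log_L_R (of_real ((1 + real m) / 2) + \<i> * of_real s)) s"
    by (rule isCont_o2[where f = "\<lambda>s. of_real ((1 + real m) / 2) + \<i> * of_real s",
          OF _ DERIV_isCont[OF D]])
qed (simp add: exp_log_L_R)

lemma log_branch_derivative:
  assumes "log_branch_on_line L_R ((1 + real m) / 2) l"
  shows "((\<lambda>s. Im (l s)) has_real_derivative log_L_R_slope s) (at s)"
proof -
  obtain k where k: "\<And>s. l s = log_L_R (of_real ((1 + real m) / 2) + \<i> * of_real s) + k"
    using log_branches_differ_by_constant[OF assms log_branch_log_L_R] by blast
  obtain D where D: "(log_L_R has_field_derivative D) (at (of_real ((1 + real m) / 2) + \<i> * of_real s))"
    and "Re D = log_L_R_slope s"
    using log_L_R_derivative by blast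
  then show ?thesis unfolding k plus_complex.sel
    using DERIV_add[OF Im_along_line_has_derivative[OF D] DERIV_const[of "Im k"]] by simp
qed

end

section \<open>Fibre integrals and the principal value\<close>

text \<open>The symmetry $\nu \mapsto 1/\nu$ of the fibre integrals becomes visible here: the factor
  $\nu^{1/2}$, left over from $|u|^z$ after the weight $m$ has been removed, merges the
  two cases of \<^const>\<open>poisson_coeff\<close> into one even function of \<open>x\<close>.\<close>

lemma pv_profile_poisson_coeff:
  assumes "x \<noteq> 0"
  shows "exp (x / 2) * poisson_coeff (exp (x / 2)) n = pv_profile ((real n + 1) / 2) 1 \<bar>x\<bar>"
proof -
  have sq: "(exp (x / 2))\<^sup>2 = exp x" by (simp add: power2_eq_square exp_add[symmetric])
  show ?thesis
  proof (cases "x < 0")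
    case True
    have "exp (x / 2) * exp (x / 2) ^ n = exp (- ((real n + 1) / 2) * \<bar>x\<bar>)"
      using True by (simp add: exp_of_nat_mult[symmetric] exp_add[symmetric] field_simps)
    moreover have "\<bar>exp (x / 2)\<bar> < 1" using True by simp
    ultimately show ?thesis using True by (simp add: poisson_coeff_def pv_profile_def sq)
  next
    case False
    then have x: "x > 0" using assms by simp
    define A where "A = exp (- ((real n + 1) / 2) * \<bar>x\<bar>)"
    have A: "exp (x / 2) * inverse (exp (x / 2)) ^ n = A * exp x"
      unfolding A_def using x
      by (simp add: exp_minus[symmetric] exp_of_nat_mult[symmetric] exp_add[symmetric] field_simps)
    have q: "exp x - 1 = (1 - exp (- x)) * exp x"
      by (simp add: left_diff_distrib exp_add[symmetric])
    have "exp (x / 2) * poisson_coeff (exp (x / 2)) n = exp (x / 2) * inverse (exp (x / 2)) ^ n / (exp x - 1)"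
      using x by (simp add: poisson_coeff_def sq)
    also have "\<dots> = A / (1 - exp (- x))"
      unfolding A q by simp
    also have "\<dots> = pv_profile ((real n + 1) / 2) 1 \<bar>x\<bar>"
      using x by (simp add: pv_profile_def A_def)
    finally show ?thesis .
  qed
qed

text \<open>With $E = e^{-|x|/2}$ these are $\frac{E}{1-E^2} + \frac{E}{1+E^2} = \frac{2E}{1-E^4}$ and
  $\frac{E}{1-E^2} - \frac{E}{1+E^2} = \frac{2E^3}{1-E^4}$. The second term on the left comes from the circle
  $wj$.\<close>

lemma pv_profile_duplication:
  assumes "x \<noteq> 0"
  shows "pv_profile (1/2) 1 \<bar>x\<bar> + exp (x / 2) / (1 + exp x) = pv_profile (1/2) 2 \<bar>x\<bar>"
    and "pv_profile (1/2) 1 \<bar>x\<bar> - exp (x / 2) / (1 + exp x) = pv_profile (3/2) 2 \<bar>x\<bar>"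
proof -
  define E where "E = exp (- \<bar>x\<bar> / 2)"
  have E: "0 < E" "E < 1" using assms by (simp_all add: E_def)
  have E2: "exp (- \<bar>x\<bar>) = E\<^sup>2" and E4: "exp (- 2 * \<bar>x\<bar>) = E ^ 4" and E3: "exp (- (3/2) * \<bar>x\<bar>) = E ^ 3"
    by (simp_all add: E_def exp_of_nat_mult[symmetric])
  have nz: "1 - E\<^sup>2 \<noteq> 0" "1 + E\<^sup>2 \<noteq> 0" 
    using E by (auto simp: power2_eq_1_iff add_nonneg_eq_0_iff)
  have f: "1 - E ^ 4 = (1 - E\<^sup>2) * (1 + E\<^sup>2)" by (simp add: algebra_simps power2_eq_square power4_eq_xxxx)
  have j: "exp (x / 2) / (1 + exp x) = E / (1 + E\<^sup>2)"
  proof (cases "x < 0")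
    case True
    then show ?thesis by (simp add: E_def power2_eq_square exp_add[symmetric])
  next
    case False
    then have "E = inverse (exp (x / 2))" by (simp add: E_def exp_minus)
    moreover have "exp x = (exp (x / 2))\<^sup>2" by (simp add: power2_eq_square exp_add[symmetric])
    moreover have "u / (1 + u\<^sup>2) = inverse u / (1 + (inverse u)\<^sup>2)" if "u > 0" for u :: real
    proof -
      have "1 + u\<^sup>2 \<noteq> 0" "1 + (inverse u)\<^sup>2 \<noteq> 0" by (simp_all add: add_nonneg_eq_0_iff)
      moreover have "u * (1 + (inverse u)\<^sup>2) = inverse u * (1 + u\<^sup>2)"
        using that by (simp add: field_simps power2_eq_square)
      ultimately show ?thesis by (simp add: frac_eq_eq)
    qed
    ultimately show ?thesis by (simp only: exp_gt_zero)
  qed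
  have p: "pv_profile (1/2) 1 \<bar>x\<bar> = E / (1 - E\<^sup>2)"
    "pv_profile (1/2) 2 \<bar>x\<bar> = 2 * E / ((1 - E\<^sup>2) * (1 + E\<^sup>2))"
    "pv_profile (3/2) 2 \<bar>x\<bar> = 2 * E ^ 3 / ((1 - E\<^sup>2) * (1 + E\<^sup>2))"
    using E2 E3 E4 unfolding pv_profile_def f[symmetric] by (simp_all add: E_def)
  show "pv_profile (1/2) 1 \<bar>x\<bar> + exp (x / 2) / (1 + exp x) = pv_profile (1/2) 2 \<bar>x\<bar>"
    "pv_profile (1/2) 1 \<bar>x\<bar> - exp (x / 2) / (1 + exp x) = pv_profile (3/2) 2 \<bar>x\<bar>"
    unfolding p j using nz by (simp_all add: field_simps power3_eq_cube power2_eq_square)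
qed

context real_hodge
begin

definition weil_integrand :: "complex \<Rightarrow> quaternion \<Rightarrow> complex" where
  "weil_integrand z u = endo_trace (weil_rep u) * of_real (nrd u) powr z / of_real (nrd (1 - u))"

text \<open>Here \<open>r\<close> is the square root of \<open>\<nu>\<close>, extended to negative \<open>\<nu>\<close> as an odd function.
  The power $|u|^z$ is written with an explicit logarithm, which makes measurability evident.\<close>

definition fibre_value :: "complex \<Rightarrow> real \<Rightarrow> complex" where
  "fibre_value z r = exp (z * of_real (ln (r\<^sup>2))) * of_real (inverse r ^ m) *
     ((\<Sum>(p, q)\<in>{(p, q). p < q \<and> p + q = m}. of_nat (hodge_number p q) * of_real (poisson_coeff r (q - p)))
      + (\<Sum>p\<in>{p. 2 * p = m}. of_nat (hodge_plus p) * of_real ((poisson_coeff r 0 + 1 / (1 + r\<^sup>2)) / 2)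
          + of_nat (hodge_minus p) * of_real ((poisson_coeff r 0 - 1 / (1 + r\<^sup>2)) / 2)))"

lemma character_on_circle:
  assumes "p + q = m" "r \<noteq> 0"
  shows "(of_real r * cis \<theta>) powi (- int p) * cnj (of_real r * cis \<theta>) powi (- int q)
     = of_real (inverse r ^ m) * cis (of_int (int q - int p) * \<theta>)"
proof -
  have "(of_real r * cis \<theta>) powi (- int p) = of_real (inverse r ^ p) * cis (- (real p * \<theta>))"
    by (simp add: power_int_minus power_mult_distrib Complex.DeMoivre power_inverse)
  moreover have "cnj (of_real r * cis \<theta>) powi (- int q) = of_real (inverse r ^ q) * cis (real q * \<theta>)"
    by (simp add: power_int_minus power_mult_distrib cis_cnj Complex.DeMoivre power_inverse)
  ultimately show ?thesis
    by (simp add: assms(1)[symmetric] power_add cis_mult algebra_simps)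
qed

text \<open>Every term on the first circle is a multiple of some $e^{ik\theta}/|1-re^{i\theta}|^2$, and the
  integrand on the second circle is constant. The weights $1/(4\pi)$ turn the coefficients
  $2\pi(h^{p,q} + h^{q,p})$ into $h^{p,q}$ and produce the halves on the diagonal.\<close>

lemma weil_integrand_fibre:
  fixes \<nu> :: real and z :: complex
  assumes \<nu>: "\<nu> \<noteq> 0" "\<nu> \<noteq> 1" "\<nu> \<noteq> -1"
  defines "\<phi> \<equiv> weil_integrand z"
  shows "fibre_integrable \<phi> \<nu>" and "fibre_integral \<phi> \<nu> = fibre_value z (sqrt \<nu>)"
proof -
  define r where "r = sqrt \<nu>"
  have r0: "r \<noteq> 0" using \<nu> by (simp add: r_def)
  have r1: "\<bar>r\<bar> \<noteq> 1"
  proof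
    assume "\<bar>r\<bar> = 1"
    then have "sqrt \<nu> = 1 \<or> sqrt (- \<nu>) = 1" by (auto simp: r_def real_sqrt_minus abs_if split: if_splits)
    then have "\<nu> = 1 \<or> - \<nu> = 1" by (simp only: real_sqrt_eq_1_iff)
    then show False using \<nu> by linarith
  qed
  define K where "K = exp (z * of_real (ln (r\<^sup>2))) * of_real (inverse r ^ m)"
  have powr: "of_real (r\<^sup>2) powr z = exp (z * of_real (ln (r\<^sup>2)))"
    using r0 by (simp add: powr_def Ln_of_real del: of_real_power)
  define e where "e k \<theta> = cis (of_int k * \<theta>) / of_real ((cmod (1 - of_real r * cis \<theta>))\<^sup>2)" for k \<theta>
  let ?L = "{(p, q). p < q \<and> p + q = m}" and ?D = "{p. 2 * p = m}"
  have C: "\<phi> (fibre_C \<nu> \<theta>) = K * ((\<Sum>(p, q)\<in>?L. of_nat (hodge_number p q) * (e (int q - int p) \<theta> + e (int p - int q) \<theta>))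
      + (\<Sum>p\<in>?D. (of_nat (hodge_plus p) + of_nat (hodge_minus p)) * e 0 \<theta>))" for \<theta>
  proof -
    have w: "of_real r * cis \<theta> \<noteq> 0" using r0 by simp
    define d where "d = complex_of_real ((cmod (1 - of_real r * cis \<theta>))\<^sup>2)"
    have "endo_trace (weil_rep (Quat (of_real r * cis \<theta>) 0)) =
      of_real (inverse r ^ m) * ((\<Sum>(p, q)\<in>?L. of_nat (hodge_number p q) *
          (cis (of_int (int q - int p) * \<theta>) + cis (of_int (int p - int q) * \<theta>)))
      + (\<Sum>p\<in>?D. (of_nat (hodge_plus p) + of_nat (hodge_minus p)) * cis (of_int 0 * \<theta>)))"
      unfolding trace_weil_rep_C[OF w] distrib_left sum_distrib_left
    proof (intro arg_cong2[where f = "(+)"] sum.cong refl, goal_cases)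
      case (1 i)
      then obtain p q where i: "i = (p, q)" "p + q = m" "q + p = m" by auto
      show ?case unfolding i(1) prod.case
        by (simp only: character_on_circle[OF i(2) r0] character_on_circle[OF i(3) r0])
          (simp only: distrib_left mult_ac)
    next
      case (2 p)
      then have "p + p = m" by simp
      from character_on_circle[OF this r0] show ?case by (simp add: mult_ac)
    qed
    moreover have "nrd (Quat (of_real r * cis \<theta>) 0) = r\<^sup>2"
      by (simp add: nrd_simps norm_mult)
    ultimately have "\<phi> (fibre_C \<nu> \<theta>) = K * ((\<Sum>(p, q)\<in>?L. of_nat (hodge_number p q) *
          (cis (of_int (int q - int p) * \<theta>) + cis (of_int (int p - int q) * \<theta>)))
      + (\<Sum>p\<in>?D. (of_nat (hodge_plus p) + of_nat (hodge_minus p)) * cis (of_int 0 * \<theta>))) / d"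
      unfolding \<phi>_def weil_integrand_def fibre_C_def r_def[symmetric] nrd_simps(3) d_def[symmetric]
      by (simp only: powr K_def mult_ac)
    then show ?thesis
      unfolding e_def d_def[symmetric]
      by (simp only: case_prod_unfold add_divide_distrib[symmetric] times_divide_eq_right
          sum_divide_distrib[symmetric])
  qed
  have J: "\<phi> (fibre_j \<nu> \<theta>) = K * (\<Sum>p\<in>?D. (of_nat (hodge_plus p) - of_nat (hodge_minus p)) * of_real (1 / (1 + r\<^sup>2)))" for \<theta>
  proof -
    have w: "of_real r * cis \<theta> \<noteq> 0" using r0 by simp
    have "endo_trace (weil_rep (Quat (of_real r * cis \<theta>) 0 * quat_j)) =
      of_real (inverse r ^ m) * (\<Sum>p\<in>?D. of_nat (hodge_plus p) - of_nat (hodge_minus p))"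
      unfolding trace_weil_rep_j[OF w] sum_distrib_left
    proof (intro sum.cong refl, goal_cases)
      case (1 p)
      then have "p + p = m" by simp
      from character_on_circle[OF this r0] show ?case by (simp add: mult_ac)
    qed
    moreover have "nrd (Quat (of_real r * cis \<theta>) 0 * quat_j) = r\<^sup>2"
      "nrd (1 - Quat (of_real r * cis \<theta>) 0 * quat_j) = 1 + r\<^sup>2"
      by (simp_all only: nrd_simps) (simp_all add: norm_mult)
    ultimately show ?thesis
      unfolding \<phi>_def weil_integrand_def fibre_j_def r_def[symmetric]
      by (simp only: powr K_def sum_distrib_right[symmetric] of_real_divide of_real_1) (simp add: mult_ac)
  qed
  have e_int: "(e k has_integral of_real (2 * pi * poisson_coeff r (nat \<bar>k\<bar>))) {0..2*pi}" for k
    unfolding e_def by (rule poisson_kernel[OF r1])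
  have e_cont: "continuous_on {0..2*pi} (e k)" for k
    unfolding e_def cis_conv_exp using one_minus_cis_nonzero[OF r1]
    by (intro continuous_intros) (auto simp: cis_conv_exp)
  have cont: "continuous_on {0..2*pi} (\<lambda>\<theta>. \<phi> (fibre_C \<nu> \<theta>))"
    unfolding C case_prod_unfold by (intro continuous_intros e_cont)
  have int_C: "set_integrable lborel {0..2*pi} (\<lambda>\<theta>. \<phi> (fibre_C \<nu> \<theta>))"
    by (rule borel_integrable_atLeastAtMost'[OF cont])
  have int_J: "set_integrable lborel {0..2*pi} (\<lambda>\<theta>. \<phi> (fibre_j \<nu> \<theta>))"
    unfolding J by (rule borel_integrable_atLeastAtMost') (rule continuous_on_const)
  show "fibre_integrable \<phi> \<nu>"
    unfolding fibre_integrable_def using int_C int_J by blast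
  have "((\<lambda>\<theta>. \<phi> (fibre_C \<nu> \<theta>)) has_integral
     K * ((\<Sum>(p, q)\<in>?L. of_nat (hodge_number p q) *
            (of_real (2 * pi * poisson_coeff r (nat \<bar>int q - int p\<bar>)) + of_real (2 * pi * poisson_coeff r (nat \<bar>int p - int q\<bar>))))
      + (\<Sum>p\<in>?D. (of_nat (hodge_plus p) + of_nat (hodge_minus p)) * of_real (2 * pi * poisson_coeff r (nat \<bar>0\<bar>))))) {0..2*pi}"
    unfolding C case_prod_unfold
    by (intro has_integral_mult_right has_integral_add has_integral_sum
        finite_index[unfolded case_prod_unfold] e_int)
  then have VC: "(LINT \<theta>:{0..2*pi}|lborel. \<phi> (fibre_C \<nu> \<theta>)) =
     K * ((\<Sum>(p, q)\<in>?L. of_nat (hodge_number p q) *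
            (of_real (2 * pi * poisson_coeff r (nat \<bar>int q - int p\<bar>)) + of_real (2 * pi * poisson_coeff r (nat \<bar>int p - int q\<bar>))))
      + (\<Sum>p\<in>?D. (of_nat (hodge_plus p) + of_nat (hodge_minus p)) * of_real (2 * pi * poisson_coeff r (nat \<bar>0\<bar>))))"
    unfolding set_borel_integral_eq_integral(2)[OF int_C] by (rule integral_unique)
  have "(\<Sum>(p, q)\<in>?L. of_nat (hodge_number p q) *
            (of_real (2 * pi * poisson_coeff r (nat \<bar>int q - int p\<bar>)) + of_real (2 * pi * poisson_coeff r (nat \<bar>int p - int q\<bar>))))
       = of_real (4 * pi) * (\<Sum>(p, q)\<in>?L. of_nat (hodge_number p q) * complex_of_real (poisson_coeff r (q - p)))"
    unfolding sum_distrib_left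
  proof (intro sum.cong refl, goal_cases)
    case (1 i)
    then obtain p q where i: "i = (p, q)" "p < q" by auto
    then have "nat \<bar>int q - int p\<bar> = q - p" "nat \<bar>int p - int q\<bar> = q - p" by auto
    then show ?case by (simp add: i(1))
  qed
  note VC = VC[unfolded this]
  have VJ: "(LINT \<theta>:{0..2*pi}|lborel. \<phi> (fibre_j \<nu> \<theta>)) = of_real (2 * pi) *
      (K * (\<Sum>p\<in>?D. (of_nat (hodge_plus p) - of_nat (hodge_minus p)) * of_real (1 / (1 + r\<^sup>2))))"
    unfolding set_borel_integral_eq_integral(2)[OF int_J] unfolding J
    by (simp add: scaleR_conv_of_real)
  have D: "(\<Sum>p\<in>?D. (of_nat (hodge_plus p) + of_nat (hodge_minus p)) * of_real (2 * pi * poisson_coeff r (nat \<bar>0\<bar>)))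
      + of_real (2 * pi) * (\<Sum>p\<in>?D. (of_nat (hodge_plus p) - of_nat (hodge_minus p)) * complex_of_real (1 / (1 + r\<^sup>2)))
      = of_real (4 * pi) * (\<Sum>p\<in>?D. of_nat (hodge_plus p) * of_real ((poisson_coeff r 0 + 1 / (1 + r\<^sup>2)) / 2)
          + of_nat (hodge_minus p) * of_real ((poisson_coeff r 0 - 1 / (1 + r\<^sup>2)) / 2))"
  proof -
    have e0: "nat \<bar>0 :: int\<bar> = 0" by simp
    have alg: "(h + k) * of_real (2 * pi * a) + of_real (2 * pi) * ((h - k) * of_real b)
        = of_real (4 * pi) * (h * of_real ((a + b) / 2) + k * of_real ((a - b) / 2))"
      for h k :: complex and a b
      by (simp add: field_simps)
    show ?thesis
      unfolding sum_distrib_left sum.distrib[symmetric] by (simp only: alg e0)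
  qed
  have pi0: "of_real (4 * pi) \<noteq> (0 :: complex)" by simp
  have "(LINT \<theta>:{0..2*pi}|lborel. \<phi> (fibre_C \<nu> \<theta>)) + (LINT \<theta>:{0..2*pi}|lborel. \<phi> (fibre_j \<nu> \<theta>))
      = of_real (4 * pi) * fibre_value z r"
    unfolding VC VJ fibre_value_def K_def[symmetric]
      mult.left_commute[of "of_real (2 * pi)" K] mult.left_commute[of "of_real (4 * pi)" K]
      distrib_left[symmetric] add.assoc D ..
  then show "fibre_integral \<phi> \<nu> = fibre_value z (sqrt \<nu>)"
    unfolding fibre_integral_def r_def[symmetric] using pi0 by (simp only: nonzero_mult_div_cancel_left not_False_eq_True)
qed

text \<open>The Borel measurability of the fibre integral on the whole line follows from its explicit value
  away from the three points $0$, $1$, $-1$.\<close>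

lemma fibre_integral_measurable: "fibre_integral (weil_integrand z) \<in> borel_measurable borel"
proof -
  have [measurable]: "(\<lambda>r. poisson_coeff r n) \<in> borel_measurable borel" for n
    unfolding poisson_coeff_def by measurable
  have "(\<lambda>\<nu>. fibre_value z (sqrt \<nu>)) \<in> borel_measurable borel"
    unfolding fibre_value_def case_prod_unfold by measurable
  then show ?thesis
    by (rule measurable_discrete_difference[where X = "{0, 1, -1}"])
      (auto simp: weil_integrand_fibre(2))
qed

lemma fibre_value_exp:
  assumes "x \<noteq> 0"
  shows "fibre_value (of_real ((1 + real m) / 2) + \<i> * of_real s) (exp (x / 2)) =
     (\<Sum>(p, q)\<in>{(p, q). p < q \<and> p + q = m}.
        (2 * of_nat (hodge_number p q)) * pv_kernel (real (q - p + 1) / 2) 1 s x) +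
     (\<Sum>p\<in>{p. 2 * p = m}. of_nat (hodge_plus p) * pv_kernel (1 / 2) 2 s x
                         + of_nat (hodge_minus p) * pv_kernel (3 / 2) 2 s x)"
proof -
  define K where "K = of_real (exp (x / 2)) * cis (s * x)"
  have "ln ((exp (x / 2))\<^sup>2) = x" by (simp add: ln_realpow)
  then have K: "exp ((of_real ((1 + real m) / 2) + \<i> * of_real s) * of_real (ln ((exp (x / 2))\<^sup>2)))
      * of_real (inverse (exp (x / 2)) ^ m) = K"
    unfolding K_def cis_conv_exp
    by (simp only: exp_minus[symmetric] exp_of_nat_mult[symmetric] exp_of_real[symmetric] exp_add[symmetric])
      (simp add: algebra_simps add_divide_distrib)
  have P: "K * of_real (poisson_coeff (exp (x / 2)) n) = 2 * pv_kernel ((real n + 1) / 2) 1 s x" for n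
    unfolding pv_kernel_def pv_profile_poisson_coeff[OF assms, symmetric] K_def by simp
  have sq: "(exp (x / 2))\<^sup>2 = exp x" by (simp add: power2_eq_square exp_add[symmetric])
  have D: "K * of_real ((poisson_coeff (exp (x / 2)) 0 + 1 / (1 + (exp (x / 2))\<^sup>2)) / 2) = pv_kernel (1 / 2) 2 s x"
     "K * of_real ((poisson_coeff (exp (x / 2)) 0 - 1 / (1 + (exp (x / 2))\<^sup>2)) / 2) = pv_kernel (3 / 2) 2 s x"
    unfolding pv_kernel_def pv_profile_duplication[OF assms, symmetric] K_def sq
    using pv_profile_poisson_coeff[OF assms, of 0, symmetric]
    by (simp_all add: field_simps)
  show ?thesis
    unfolding fibre_value_def K distrib_left sum_distrib_left
  proof (intro arg_cong2[where f = "(+)"] sum.cong refl, goal_cases)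
    case (1 i)
    obtain p q where i: "i = (p, q)" by (cases i)
    have "(real (q - p) + 1) / 2 = real (q - p + 1) / 2" by simp
    from P[of "q - p", unfolded this] show ?case
      unfolding i prod.case by (simp only: mult.left_commute[of K] mult_ac)
  next
    case (2 p)
    then show ?case by (simp only: mult.left_commute[of K] D)
  next
    case (3 p)
    then show ?case by (simp only: mult.left_commute[of K] D)
  qed
qed

lemma weil_pv_of_integrand:
  "has_weil_pv (weil_integrand (of_real ((1 + real m) / 2) + \<i> * of_real s))
     (of_real (- 2 * log_L_R_slope s))"
proof -
  let ?L = "{(p, q). p < q \<and> p + q = m}" and ?D = "{p. 2 * p = m}"
  let ?V = "\<lambda>a b. complex_of_real (ln (2 * pi) - ln b - Re (Digamma ((of_real a + \<i> * of_real s) / of_real b)))"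
  define z where "z = of_real ((1 + real m) / 2) + \<i> * of_real s"
  define I where "I = (\<Sum>(p, q)\<in>?L. (2 * of_nat (hodge_number p q)) * ?V (real (q - p + 1) / 2) 1) +
     (\<Sum>p\<in>?D. of_nat (hodge_plus p) * ?V (1 / 2) 2 + of_nat (hodge_minus p) * ?V (3 / 2) 2)"
  define c where "c = (\<Sum>(p, q)\<in>?L. (2 * of_nat (hodge_number p q)) * (1 / 2 :: complex)) +
     (\<Sum>p\<in>?D. of_nat (hodge_plus p) * (1 / 2) + of_nat (hodge_minus p) * (1 / 2))"
  have "line_pv (\<lambda>x. (\<Sum>(p, q)\<in>?L. (2 * of_nat (hodge_number p q)) * pv_kernel (real (q - p + 1) / 2) 1 s x) +
     (\<Sum>p\<in>?D. of_nat (hodge_plus p) * pv_kernel (1 / 2) 2 s x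
                         + of_nat (hodge_minus p) * pv_kernel (3 / 2) 2 s x)) c I"
    unfolding c_def I_def
  proof (intro line_pv_add line_pv_sum finite_index, goal_cases)
    case (1 i)
    obtain p q where i: "i = (p, q)" by (cases i)
    show ?case unfolding i prod.case by (intro line_pv_scale line_pv_kernel) auto
  qed (intro line_pv_scale line_pv_kernel; simp)+
  then have "has_weil_pv (weil_integrand z) I"
  proof (rule has_weil_pvI[rotated 3])
    show "fibre_integrable (weil_integrand z) \<nu>" if "\<nu> > 0" "\<nu> \<noteq> 1" for \<nu>
      using that by (intro weil_integrand_fibre) auto
    show "fibre_integral (weil_integrand z) \<in> borel_measurable borel"
      by (rule fibre_integral_measurable)
    fix x :: real assume x: "x \<noteq> 0"
    have "sqrt (exp x) = exp (x / 2)"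
      by (rule real_sqrt_unique) (simp_all add: power2_eq_square exp_add[symmetric])
    moreover have "fibre_integral (weil_integrand z) (exp x) = fibre_value z (sqrt (exp x))"
      using x by (intro weil_integrand_fibre) (use exp_gt_zero[of x] in \<open>linarith | simp\<close>)+
    ultimately show "fibre_integral (weil_integrand z) (exp x) =
      (\<Sum>(p, q)\<in>?L. (2 * of_nat (hodge_number p q)) * pv_kernel (real (q - p + 1) / 2) 1 s x) +
      (\<Sum>p\<in>?D. of_nat (hodge_plus p) * pv_kernel (1 / 2) 2 s x
                         + of_nat (hodge_minus p) * pv_kernel (3 / 2) 2 s x)"
      unfolding z_def by (simp only: fibre_value_exp[OF x])
  qed
  moreover have "I = of_real (- 2 * log_L_R_slope s)"
    unfolding I_def log_L_R_slope_def distrib_left[of "-2"] sum_distrib_left of_real_add of_real_sum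
  proof (intro arg_cong2[where f = "(+)"] sum.cong refl, goal_cases)
    case (1 i)
    obtain p q where i: "i = (p, q)" by (cases i)
    show ?case unfolding i prod.case by (simp add: algebra_simps)
  next
    case (2 p)
    \<comment> \<open>The scale \<open>b = 2\<close> turns $\log 2\pi$ into the $\log\pi$ of the real Gamma factor.\<close>
    have "ln (2 * pi) - ln 2 = ln pi" by (simp add: ln_mult)
    then show ?case by (simp only:) (simp add: field_simps)
  next
    case (3 p)
    have "ln (2 * pi) - ln 2 = ln pi" by (simp add: ln_mult)
    then show ?case by (simp only:) (simp add: field_simps)
  qed
  ultimately show ?thesis by (simp only: z_def)
qed

end

theorem theorem7p6:
  fixes scale :: "complex \<Rightarrow> 'v::ab_group_add \<Rightarrow> 'v"
    and Basis :: "'v set"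
    and m :: nat
    and H :: "nat \<Rightarrow> nat \<Rightarrow> 'v set"
    and F :: "'v \<Rightarrow> 'v"
  assumes "real_hodge scale Basis m H F"
  shows "(\<exists>l. log_branch_on_line (real_hodge.L_R scale m H F) ((1 + real m) / 2) l) \<and>
    (\<forall>l. log_branch_on_line (real_hodge.L_R scale m H F) ((1 + real m) / 2) l \<longrightarrow>
      (\<forall>s::real. \<forall>z::complex. z = of_real ((1 + real m) / 2) + \<i> * of_real s \<longrightarrow>
        (\<lambda>s. Im (l s)) differentiable (at s) \<and>
        has_weil_pv
          (\<lambda>u. real_hodge.endo_trace scale Basis (real_hodge.weil_rep scale m H F u)
                 * of_real (nrd u) powr z / of_real (nrd (1 - u)))
          (of_real (- 2 * deriv (\<lambda>s. Im (l s)) s))))"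
proof -
  interpret real_hodge scale Basis m H F by fact
  show ?thesis
  proof (intro conjI allI impI)
    show "\<exists>l. log_branch_on_line L_R ((1 + real m) / 2) l"
      using log_branch_log_L_R by blast
    fix l s and z :: complex
    assume l: "log_branch_on_line L_R ((1 + real m) / 2) l"
      and z: "z = of_real ((1 + real m) / 2) + \<i> * of_real s"
    have d: "((\<lambda>s. Im (l s)) has_real_derivative log_L_R_slope s) (at s)"
      by (rule log_branch_derivative[OF l])
    then show "(\<lambda>s. Im (l s)) differentiable (at s)"
      by (auto simp: real_differentiable_def)
    show "has_weil_pv (\<lambda>u. endo_trace (weil_rep u) * of_real (nrd u) powr z / of_real (nrd (1 - u)))
        (of_real (- 2 * deriv (\<lambda>s. Im (l s)) s))"
      using weil_pv_of_integrand[of s]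
      unfolding DERIV_imp_deriv[OF d] z weil_integrand_def[abs_def] .
  qed
qed

end
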